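(* Let $k\ge 0$ be an integer, let $H$ be a PSH-algebra and let $(M,\alpha,\alpha^* )$ be a $k$-PSH module over $H$. With $\mathcal{C},\mathcal{D}$, $S(\mathcal{C},\mathbb{Z}^{\ge 0})$, $\Omega(d,\phi)$, $H(\phi)$, $M(d,\phi)$, $M(d)$ as defined in the context, the following hold. For $d,d'\in\mathcal{D}$ and $\phi,\phi'\in S(\mathcal{C},\mathbb{Z}^{\ge 0})$, the sets $\Omega(d,\phi)$ and $\Omega(d',\phi')$ are disjoint unless $(d,\phi)=(d',\phi')$. $M$ has the T-group decomposition $$M=\bigoplus_{d\in\mathcal{D},\ \phi\in S(\mathcal{C},\mathbb{Z}^{\ge 0})} M(d,\phi)$$ and is graded with respect to $S(\mathcal{C},\mathbb{Z}^{\ge 0})$ in the sense that, for all $d\in\mathcal{D}$ and $\phi,\phi',\phi''\in S(\mathcal{C},\mathbb{Z}^{\ge 0})$, $$\alpha(H(\phi')\otimes M(d,\phi''))\subset M(d,\phi'+\phi''),\qquad \alpha^*(M(d,\phi))\subset\bigoplus_{\phi'+\phi''=\phi}H(\phi')\otimes M(d,\phi'').$$ In particular each $M(d)$ is a $k$-PSH submodule of $M$, and as $k$-PSH modules $$M=\bigoplus_{d\in\mathcal{D}}M(d).$$ Thus $M$ has a unique decomposition as a direct sum of $k$-PSH submodules each having a single (module) primitive irreducible element.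
   Context: A T-group is a free abelian group $M$ with a specified $\mathbb{Z}$-basis $\Omega(M)$, whose elements are called irreducible; $\langle\cdot,\cdot\rangle$ is the bilinear form making $\Omega(M)$ orthonormal. An element $x$ is positive if $\langle x,\omega\rangle\ge 0$ for all $\omega\in\Omega(M)$; $\omega\in\Omega(M)$ is an irreducible constituent of a positive $x$, written $\omega\le x$, if $\langle\omega,x\rangle>0$. $\mathbb{Z}$ is a T-group with irreducible element $1$; irreducibles of a tensor product are tensor products of irreducibles, and irreducibles of a direct sum are the disjoint union of irreducibles of the summands. A T-group is graded if $M=\bigoplus_{n\ge 0}M_n$ with every irreducible element homogeneous. A map of T-groups is positive if it sends positive elements to positive elements; maps $f:M\to N$, $g:N\to M$ are adjoint if $\langle f(m),n\rangle=\langle m,g(n)\rangle$ for all $m,n$. A PSH-algebra is a Hopf algebra $(H,\mu,\mu^*,e,e^*,T)$ over $\mathbb{Z}$ (multiplication, comultiplication, unit, counit, antipode) that is a graded T-group $H=\bigoplus_{n\ge 0}H_n$, with all structure maps graded ($\mathbb{Z}$ in degree $0$; no signs), connected ($e:\mathbb{Z}\to H_0$ and $e^*:H_0\to\mathbb{Z}$ are mutually inverse isomorphisms), with $\mu,\mu^*,e,e^*$ positive and with $(\mu,\mu^* )$, $(e,e^* )$ pairs of adjoint maps. PSH-algebras are commutative and cocommutative (Zelevinsky). For $k\ge1$, $\mu^{(k)}:H^{\otimes k}\to H$ and $\mu^{*(k)}:H\to H^{\otimes k}$ are iterated multiplication and comultiplication ($\mu^{(1)}=\mu^{*(1)}=\mathrm{id}$),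 and $\Psi^k=\mu^{(k)}\circ\mu^{*(k)}$; $\Psi^0=e\circ e^*$. We use sumless Sweedler notation $\mu^*(h)=h_{(1)}\otimes h_{(2)}$, $\alpha^*(m)=m_{(1)}\otimes m_{(2)}$. A $k$-PSH module over $H$ is a graded T-group $M=\bigoplus_{n\ge0}M_n$ with graded, positive, mutually adjoint $\mathbb{Z}$-linear maps $\alpha:H\otimes M\to M$ (written $hm$) and $\alpha^*:M\to H\otimes M$ satisfying associativity $a(bm)=(ab)m$, coassociativity $(\mu^*\otimes 1)\alpha^*=(1\otimes\alpha^* )\alpha^*$, unit $e(a)m=am$, counit $e^*(m_{(1)})m_{(2)}=m$, and the $k$-Hopf axiom $\alpha^*(hm)=\Psi^k(h_{(1)})m_{(1)}\otimes h_{(2)}m_{(2)}$. A $k$-PSH submodule is a subgroup spanned by irreducible elements and stable under the action and coaction. An element $h\in H$ is primitive if $\mu^*(h)=h\otimes1+1\otimes h$; $m\in M$ is (module) primitive if $\alpha^*(m)=1\otimes m$. Let $\mathcal{C}$ be the set of primitive irreducible elements of $H$ and $\mathcal{D}$ the set of module primitive irreducible elements of $M$. $S(\mathcal{C},\mathbb{Z}^{\ge0})$ is the additive monoid of finitely supported functions $\mathcal{C}\to\mathbb{Z}^{\ge0}$. For $d\in\mathcal{D}$, $\phi\in S(\mathcal{C},\mathbb{Z}^{\ge0})$ put $\pi_\phi=\prod_{c\in\mathcal{C}}c^{\phi(c)}\in H$ and $\pi_{d,\phi}=\pi_\phi d\in M$. Let $\Omega(\phi)$ be the set of irreducible $\omega\in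 H$ with $\omega\le\pi_\phi$ and $\Omega(d,\phi)$ the set of irreducible constituents of $\pi_{d,\phi}$ in $M$. Set $H(\phi)=\bigoplus_{\omega\in\Omega(\phi)}\mathbb{Z}\omega$, $M(d,\phi)=\bigoplus_{\omega\in\Omega(d,\phi)}\mathbb{Z}\omega$, and $M(d)=\bigoplus_{\phi\in S(\mathcal{C},\mathbb{Z}^{\ge0})}M(d,\phi)$. *)

theory Defs
  imports "HOL-Algebra.Free_Abelian_Groups" "HOL-Library.Disjoint_Sets"
begin

section \<open>T-groups\<close>

text \<open>
  The T-group with set of irreducible elements \<open>\<Omega>\<close> is \<open>free_Abelian_group \<Omega>\<close>, the group of finitely
  supported functions \<open>\<Omega> \<rightarrow> \<int>\<close>; the irreducible element belonging to \<open>\<omega> \<in> \<Omega>\<close> is \<open>frag_of \<omega>\<close>.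
  Every free abelian group with a specified basis is of this form, with the basis as \<open>\<Omega>\<close>.
  Accordingly, the tensor product of the T-groups on \<open>A\<close> and \<open>B\<close> is the T-group on \<open>A \<times> B\<close>,
  and its pure tensors are given by \<open>tensor\<close> below.
  The T-group \<open>\<int>\<close> with irreducible element \<open>1\<close> is \<open>integer_group\<close>.
\<close>

abbreviation tspan :: "'a set \<Rightarrow> ('a \<Rightarrow>\<^sub>0 int) set"
  where "tspan \<Omega> \<equiv> carrier (free_Abelian_group \<Omega>)"

definition form :: "('a \<Rightarrow>\<^sub>0 int) \<Rightarrow> ('a \<Rightarrow>\<^sub>0 int) \<Rightarrow> int"
  where "form x y = (\<Sum>\<omega>\<in>Poly_Mapping.keys x. poly_mapping.lookup x \<omega> * poly_mapping.lookup y \<omega>)"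

definition positive :: "'a set \<Rightarrow> ('a \<Rightarrow>\<^sub>0 int) \<Rightarrow> bool"
  where "positive \<Omega> x \<longleftrightarrow> x \<in> tspan \<Omega> \<and> (\<forall>\<omega>\<in>\<Omega>. form x (frag_of \<omega>) \<ge> 0)"

definition constituents :: "'a set \<Rightarrow> ('a \<Rightarrow>\<^sub>0 int) \<Rightarrow> 'a set"
  where "constituents \<Omega> x = {\<omega>\<in>\<Omega>. form (frag_of \<omega>) x > 0}"

definition positive_map :: "'a set \<Rightarrow> 'b set \<Rightarrow> (('a \<Rightarrow>\<^sub>0 int) \<Rightarrow> ('b \<Rightarrow>\<^sub>0 int)) \<Rightarrow> bool"
  where "positive_map A B f \<longleftrightarrow> (\<forall>x. positive A x \<longrightarrow> positive B (f x))"

definition adjoint_maps ::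
  "'a set \<Rightarrow> 'b set \<Rightarrow> (('a \<Rightarrow>\<^sub>0 int) \<Rightarrow> ('b \<Rightarrow>\<^sub>0 int)) \<Rightarrow> (('b \<Rightarrow>\<^sub>0 int) \<Rightarrow> ('a \<Rightarrow>\<^sub>0 int)) \<Rightarrow> bool"
  where "adjoint_maps A B f g \<longleftrightarrow> (\<forall>x\<in>tspan A. \<forall>y\<in>tspan B. form (f x) y = form x (g y))"

text \<open>
  Since irreducible elements are required to be homogeneous, a grading of the T-group on \<open>\<Omega>\<close> is
  a degree function \<open>\<Omega> \<rightarrow> \<nat>\<close>.
\<close>

definition homogeneous :: "'a set \<Rightarrow> ('a \<Rightarrow> nat) \<Rightarrow> nat \<Rightarrow> ('a \<Rightarrow>\<^sub>0 int) set"
  where "homogeneous \<Omega> deg n = tspan {\<omega>\<in>\<Omega>. deg \<omega> = n}"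

definition tensor_deg :: "('a \<Rightarrow> nat) \<Rightarrow> ('b \<Rightarrow> nat) \<Rightarrow> 'a \<times> 'b \<Rightarrow> nat"
  where "tensor_deg d d' = (\<lambda>(a, b). d a + d' b)"

definition graded_map ::
  "'a set \<Rightarrow> ('a \<Rightarrow> nat) \<Rightarrow> 'b set \<Rightarrow> ('b \<Rightarrow> nat) \<Rightarrow> (('a \<Rightarrow>\<^sub>0 int) \<Rightarrow> ('b \<Rightarrow>\<^sub>0 int)) \<Rightarrow> bool"
  where "graded_map A d B d' f \<longleftrightarrow> (\<forall>n. f ` homogeneous A d n \<subseteq> homogeneous B d' n)"

definition tensor :: "('a \<Rightarrow>\<^sub>0 int) \<Rightarrow> ('b \<Rightarrow>\<^sub>0 int) \<Rightarrow> ('a \<times> 'b \<Rightarrow>\<^sub>0 int)"  (infixr \<open>\<otimes>\<^sub>t\<close> 75)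
  where "x \<otimes>\<^sub>t y = frag_extend (\<lambda>a. frag_extend (\<lambda>b. frag_of (a, b)) y) x"

text \<open>The map \<open>f \<otimes> g\<close>, for additive \<open>f\<close> and \<open>g\<close>.\<close>

definition tensor_map ::
  "(('a \<Rightarrow>\<^sub>0 int) \<Rightarrow> ('c \<Rightarrow>\<^sub>0 int)) \<Rightarrow> (('b \<Rightarrow>\<^sub>0 int) \<Rightarrow> ('d \<Rightarrow>\<^sub>0 int)) \<Rightarrow>
    ('a \<times> 'b \<Rightarrow>\<^sub>0 int) \<Rightarrow> ('c \<times> 'd \<Rightarrow>\<^sub>0 int)"
  where "tensor_map f g = frag_extend (\<lambda>(a, b). f (frag_of a) \<otimes>\<^sub>t g (frag_of b))"

definition tensor_assoc :: "(('a \<times> 'b) \<times> 'c \<Rightarrow>\<^sub>0 int) \<Rightarrow> ('a \<times> 'b \<times> 'c \<Rightarrow>\<^sub>0 int)"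
  where "tensor_assoc = frag_extend (\<lambda>((a, b), c). frag_of (a, b, c))"

text \<open>The map \<open>(w \<otimes> x) \<otimes> (y \<otimes> z) \<mapsto> (w \<otimes> y) \<otimes> (x \<otimes> z)\<close>.\<close>

definition middle_swap ::
  "(('a \<times> 'b) \<times> ('c \<times> 'd) \<Rightarrow>\<^sub>0 int) \<Rightarrow> (('a \<times> 'c) \<times> ('b \<times> 'd) \<Rightarrow>\<^sub>0 int)"
  where "middle_swap = frag_extend (\<lambda>((a, b), (c, d)). frag_of ((a, c), (b, d)))"

text \<open>
  For additive \<open>\<epsilon>\<close> with values in \<open>\<int>\<close>: the maps \<open>\<epsilon> \<otimes> 1\<close> and \<open>1 \<otimes> \<epsilon>\<close>, followed by the
  identifications of \<open>\<int> \<otimes> N\<close> and \<open>N \<otimes> \<int>\<close> with \<open>N\<close>.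
\<close>

definition contract_left :: "(('a \<Rightarrow>\<^sub>0 int) \<Rightarrow> int) \<Rightarrow> ('a \<times> 'b \<Rightarrow>\<^sub>0 int) \<Rightarrow> ('b \<Rightarrow>\<^sub>0 int)"
  where "contract_left \<epsilon> = frag_extend (\<lambda>(a, b). frag_cmul (\<epsilon> (frag_of a)) (frag_of b))"

definition contract_right :: "(('b \<Rightarrow>\<^sub>0 int) \<Rightarrow> int) \<Rightarrow> ('a \<times> 'b \<Rightarrow>\<^sub>0 int) \<Rightarrow> ('a \<Rightarrow>\<^sub>0 int)"
  where "contract_right \<epsilon> = frag_extend (\<lambda>(a, b). frag_cmul (\<epsilon> (frag_of b)) (frag_of a))"


section \<open>Subgroups and direct sums\<close>

definition subgroup_tensor ::
  "('a \<Rightarrow>\<^sub>0 int) set \<Rightarrow> ('b \<Rightarrow>\<^sub>0 int) set \<Rightarrow> ('a \<times> 'b \<Rightarrow>\<^sub>0 int) set"  (infixr \<open>\<otimes>\<^sub>s\<close> 75)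
  where "A \<otimes>\<^sub>s B = generate (free_Abelian_group UNIV) {x \<otimes>\<^sub>t y |x y. x \<in> A \<and> y \<in> B}"

definition subgroup_sum :: "'i set \<Rightarrow> ('i \<Rightarrow> ('a \<Rightarrow>\<^sub>0 int) set) \<Rightarrow> ('a \<Rightarrow>\<^sub>0 int) set"
  where "subgroup_sum I N = generate (free_Abelian_group UNIV) (\<Union>i\<in>I. N i)"

text \<open>
  Internal direct sums: the addition map from the external direct sum (\<open>sum_group\<close>) to \<open>X\<close> is an
  isomorphism.  Here \<open>sum'\<close> is summation over the support.
\<close>

definition is_direct_sum ::
  "('a \<Rightarrow>\<^sub>0 int) set \<Rightarrow> 'i set \<Rightarrow> ('i \<Rightarrow> ('a \<Rightarrow>\<^sub>0 int) set) \<Rightarrow> bool"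
  where "is_direct_sum X I N \<longleftrightarrow>
    (\<lambda>f. sum' f I) \<in> iso (sum_group I (\<lambda>i. (free_Abelian_group UNIV)\<lparr>carrier := N i\<rparr>))
                        ((free_Abelian_group UNIV)\<lparr>carrier := X\<rparr>)"

definition irreducibles_in :: "'a set \<Rightarrow> ('a \<Rightarrow>\<^sub>0 int) set \<Rightarrow> 'a set"
  where "irreducibles_in \<Omega> N = {\<omega>\<in>\<Omega>. frag_of \<omega> \<in> N}"

text \<open>
  A decomposition of the T-group on \<open>\<Omega>\<close> into sub-T-groups \<open>N i\<close>, i.e. into subgroups spanned by
  irreducible elements.
\<close>

definition tgroup_direct_sum :: "'a set \<Rightarrow> 'i set \<Rightarrow> ('i \<Rightarrow> ('a \<Rightarrow>\<^sub>0 int) set) \<Rightarrow> bool"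
  where "tgroup_direct_sum \<Omega> I N \<longleftrightarrow>
    (\<forall>i\<in>I. N i = tspan (irreducibles_in \<Omega> (N i))) \<and>
    is_direct_sum (tspan \<Omega>) I N \<and>
    disjoint_family_on (\<lambda>i. irreducibles_in \<Omega> (N i)) I \<and>
    (\<Union>i\<in>I. irreducibles_in \<Omega> (N i)) = \<Omega>"


section \<open>PSH-algebras\<close>

record 'a psh =
  Irr :: "'a set"
  Deg :: "'a \<Rightarrow> nat"
  hmult :: "('a \<times> 'a \<Rightarrow>\<^sub>0 int) \<Rightarrow> ('a \<Rightarrow>\<^sub>0 int)"
  hcomult :: "('a \<Rightarrow>\<^sub>0 int) \<Rightarrow> ('a \<times> 'a \<Rightarrow>\<^sub>0 int)"
  hunit :: "int \<Rightarrow> ('a \<Rightarrow>\<^sub>0 int)"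
  hcounit :: "('a \<Rightarrow>\<^sub>0 int) \<Rightarrow> int"
  hantipode :: "('a \<Rightarrow>\<^sub>0 int) \<Rightarrow> ('a \<Rightarrow>\<^sub>0 int)"

locale psh_algebra =
  fixes H :: "'a psh"
  assumes mult_hom: "hmult H \<in> hom (free_Abelian_group (Irr H \<times> Irr H)) (free_Abelian_group (Irr H))"
    and comult_hom: "hcomult H \<in> hom (free_Abelian_group (Irr H)) (free_Abelian_group (Irr H \<times> Irr H))"
    and unit_hom: "hunit H \<in> hom integer_group (free_Abelian_group (Irr H))"
    and counit_hom: "hcounit H \<in> hom (free_Abelian_group (Irr H)) integer_group"
    and antipode_hom: "hantipode H \<in> hom (free_Abelian_group (Irr H)) (free_Abelian_group (Irr H))"
    and assoc: "\<And>x y z. \<lbrakk>x \<in> tspan (Irr H); y \<in> tspan (Irr H); z \<in> tspan (Irr H)\<rbrakk>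
      \<Longrightarrow> hmult H (hmult H (x \<otimes>\<^sub>t y) \<otimes>\<^sub>t z) = hmult H (x \<otimes>\<^sub>t hmult H (y \<otimes>\<^sub>t z))"
    and unit_left: "\<And>x. x \<in> tspan (Irr H) \<Longrightarrow> hmult H (hunit H 1 \<otimes>\<^sub>t x) = x"
    and unit_right: "\<And>x. x \<in> tspan (Irr H) \<Longrightarrow> hmult H (x \<otimes>\<^sub>t hunit H 1) = x"
    and coassoc: "\<And>x. x \<in> tspan (Irr H)
      \<Longrightarrow> tensor_assoc (tensor_map (hcomult H) id (hcomult H x)) = tensor_map id (hcomult H) (hcomult H x)"
    and counit_left: "\<And>x. x \<in> tspan (Irr H) \<Longrightarrow> contract_left (hcounit H) (hcomult H x) = x"
    and counit_right: "\<And>x. x \<in> tspan (Irr H) \<Longrightarrow> contract_right (hcounit H) (hcomult H x) = x"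
    and comult_mult: "\<And>x y. \<lbrakk>x \<in> tspan (Irr H); y \<in> tspan (Irr H)\<rbrakk>
      \<Longrightarrow> hcomult H (hmult H (x \<otimes>\<^sub>t y)) =
        tensor_map (hmult H) (hmult H) (middle_swap (hcomult H x \<otimes>\<^sub>t hcomult H y))"
    and comult_one: "hcomult H (hunit H 1) = hunit H 1 \<otimes>\<^sub>t hunit H 1"
    and counit_mult: "\<And>x y. \<lbrakk>x \<in> tspan (Irr H); y \<in> tspan (Irr H)\<rbrakk>
      \<Longrightarrow> hcounit H (hmult H (x \<otimes>\<^sub>t y)) = hcounit H x * hcounit H y"
    and counit_one: "hcounit H (hunit H 1) = 1"
    and antipode_left: "\<And>x. x \<in> tspan (Irr H)
      \<Longrightarrow> hmult H (tensor_map (hantipode H) id (hcomult H x)) = hunit H (hcounit H x)"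
    and antipode_right: "\<And>x. x \<in> tspan (Irr H)
      \<Longrightarrow> hmult H (tensor_map id (hantipode H) (hcomult H x)) = hunit H (hcounit H x)"
    \<comment> \<open>\<open>\<int>\<close> is in degree \<open>0\<close>\<close>
    and mult_graded: "graded_map (Irr H \<times> Irr H) (tensor_deg (Deg H) (Deg H)) (Irr H) (Deg H) (hmult H)"
    and comult_graded: "graded_map (Irr H) (Deg H) (Irr H \<times> Irr H) (tensor_deg (Deg H) (Deg H)) (hcomult H)"
    and unit_graded: "\<And>n. hunit H n \<in> homogeneous (Irr H) (Deg H) 0"
    and counit_graded: "\<And>n x. \<lbrakk>x \<in> homogeneous (Irr H) (Deg H) n; n > 0\<rbrakk> \<Longrightarrow> hcounit H x = 0"
    and antipode_graded: "graded_map (Irr H) (Deg H) (Irr H) (Deg H) (hantipode H)"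
    and counit_unit: "\<And>n. hcounit H (hunit H n) = n"
    and unit_counit: "\<And>x. x \<in> homogeneous (Irr H) (Deg H) 0 \<Longrightarrow> hunit H (hcounit H x) = x"
    and mult_positive: "positive_map (Irr H \<times> Irr H) (Irr H) (hmult H)"
    and comult_positive: "positive_map (Irr H) (Irr H \<times> Irr H) (hcomult H)"
    and unit_positive: "\<And>n. n \<ge> 0 \<Longrightarrow> positive (Irr H) (hunit H n)"
    and counit_positive: "\<And>x. positive (Irr H) x \<Longrightarrow> hcounit H x \<ge> 0"
    \<comment> \<open>the form on \<open>\<int>\<close> is multiplication\<close>
    and mult_comult_adjoint: "adjoint_maps (Irr H \<times> Irr H) (Irr H) (hmult H) (hcomult H)"
    and unit_counit_adjoint: "\<And>n x. x \<in> tspan (Irr H) \<Longrightarrow> form (hunit H n) x = n * hcounit H x"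

text \<open>
  The tensor power of \<open>H\<close> with \<open>n + 1\<close> factors is the T-group on the lists over \<open>Irr H\<close> of length
  \<open>n + 1\<close>; \<open>iter_mult H n\<close> and \<open>iter_comult H n\<close> are the \<open>(n + 1)\<close>-fold iterated multiplication
  \<open>\<mu>\<^sup>(\<^sup>n\<^sup>+\<^sup>1\<^sup>)\<close> and comultiplication.
\<close>

primrec iter_mult :: "'a psh \<Rightarrow> nat \<Rightarrow> ('a list \<Rightarrow>\<^sub>0 int) \<Rightarrow> ('a \<Rightarrow>\<^sub>0 int)" where
  "iter_mult H 0 = frag_extend (\<lambda>as. frag_of (hd as))"
| "iter_mult H (Suc n) =
     hmult H \<circ> tensor_map id (iter_mult H n) \<circ> frag_extend (\<lambda>as. frag_of (hd as, tl as))"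

primrec iter_comult :: "'a psh \<Rightarrow> nat \<Rightarrow> ('a \<Rightarrow>\<^sub>0 int) \<Rightarrow> ('a list \<Rightarrow>\<^sub>0 int)" where
  "iter_comult H 0 = frag_extend (\<lambda>a. frag_of [a])"
| "iter_comult H (Suc n) =
     frag_extend (\<lambda>(a, as). frag_of (a # as)) \<circ> tensor_map id (iter_comult H n) \<circ> hcomult H"

primrec Psi :: "'a psh \<Rightarrow> nat \<Rightarrow> ('a \<Rightarrow>\<^sub>0 int) \<Rightarrow> ('a \<Rightarrow>\<^sub>0 int)" where
  "Psi H 0 = hunit H \<circ> hcounit H"
| "Psi H (Suc n) = iter_mult H n \<circ> iter_comult H n"


section \<open>PSH modules\<close>

record ('a, 'm) psh_mod =
  mIrr :: "'m set"
  mDeg :: "'m \<Rightarrow> nat"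
  act :: "('a \<times> 'm \<Rightarrow>\<^sub>0 int) \<Rightarrow> ('m \<Rightarrow>\<^sub>0 int)"
  coact :: "('m \<Rightarrow>\<^sub>0 int) \<Rightarrow> ('a \<times> 'm \<Rightarrow>\<^sub>0 int)"

locale psh_module = psh_algebra H for H :: "'a psh" +
  fixes k :: nat and M :: "('a, 'm) psh_mod"
  assumes act_hom: "act M \<in> hom (free_Abelian_group (Irr H \<times> mIrr M)) (free_Abelian_group (mIrr M))"
    and coact_hom: "coact M \<in> hom (free_Abelian_group (mIrr M)) (free_Abelian_group (Irr H \<times> mIrr M))"
    and act_graded: "graded_map (Irr H \<times> mIrr M) (tensor_deg (Deg H) (mDeg M)) (mIrr M) (mDeg M) (act M)"
    and coact_graded: "graded_map (mIrr M) (mDeg M) (Irr H \<times> mIrr M) (tensor_deg (Deg H) (mDeg M)) (coact M)"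
    and act_positive: "positive_map (Irr H \<times> mIrr M) (mIrr M) (act M)"
    and coact_positive: "positive_map (mIrr M) (Irr H \<times> mIrr M) (coact M)"
    and act_coact_adjoint: "adjoint_maps (Irr H \<times> mIrr M) (mIrr M) (act M) (coact M)"
    and act_assoc: "\<And>a b m. \<lbrakk>a \<in> tspan (Irr H); b \<in> tspan (Irr H); m \<in> tspan (mIrr M)\<rbrakk>
      \<Longrightarrow> act M (a \<otimes>\<^sub>t act M (b \<otimes>\<^sub>t m)) = act M (hmult H (a \<otimes>\<^sub>t b) \<otimes>\<^sub>t m)"
    and coact_coassoc: "\<And>m. m \<in> tspan (mIrr M)
      \<Longrightarrow> tensor_assoc (tensor_map (hcomult H) id (coact M m)) = tensor_map id (coact M) (coact M m)"
    and act_unit: "\<And>a m. m \<in> tspan (mIrr M) \<Longrightarrow> act M (hunit H a \<otimes>\<^sub>t m) = frag_cmul a m"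
    and coact_counit: "\<And>m. m \<in> tspan (mIrr M) \<Longrightarrow> contract_left (hcounit H) (coact M m) = m"
    \<comment> \<open>\<open>\<alpha>\<^sup>*(hm) = \<Psi>\<^sup>k(h\<^sub>1) m\<^sub>1 \<otimes> h\<^sub>2 m\<^sub>2\<close> in Sweedler notation\<close>
    and hopf_axiom: "\<And>h m. \<lbrakk>h \<in> tspan (Irr H); m \<in> tspan (mIrr M)\<rbrakk>
      \<Longrightarrow> coact M (act M (h \<otimes>\<^sub>t m)) =
        tensor_map (hmult H) (act M)
          (middle_swap (tensor_map (Psi H k) id (hcomult H h) \<otimes>\<^sub>t coact M m))"

definition psh_submodule :: "'a psh \<Rightarrow> ('a, 'm) psh_mod \<Rightarrow> ('m \<Rightarrow>\<^sub>0 int) set \<Rightarrow> bool"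
  where "psh_submodule H M N \<longleftrightarrow>
    (\<exists>S\<subseteq>mIrr M. N = tspan S) \<and>
    act M ` (tspan (Irr H) \<otimes>\<^sub>s N) \<subseteq> N \<and>
    coact M ` N \<subseteq> tspan (Irr H) \<otimes>\<^sub>s N"

definition submodule_direct_sum ::
  "'a psh \<Rightarrow> ('a, 'm) psh_mod \<Rightarrow> 'i set \<Rightarrow> ('i \<Rightarrow> ('m \<Rightarrow>\<^sub>0 int) set) \<Rightarrow> bool"
  where "submodule_direct_sum H M I N \<longleftrightarrow>
    (\<forall>i\<in>I. psh_submodule H M (N i)) \<and> tgroup_direct_sum (mIrr M) I N"


section \<open>The subgroups attached to primitive irreducible elements\<close>

definition primitive :: "'a psh \<Rightarrow> ('a \<Rightarrow>\<^sub>0 int) \<Rightarrow> bool"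
  where "primitive H h \<longleftrightarrow> hcomult H h = h \<otimes>\<^sub>t hunit H 1 + hunit H 1 \<otimes>\<^sub>t h"

definition mod_primitive :: "'a psh \<Rightarrow> ('a, 'm) psh_mod \<Rightarrow> ('m \<Rightarrow>\<^sub>0 int) \<Rightarrow> bool"
  where "mod_primitive H M m \<longleftrightarrow> coact M m = hunit H 1 \<otimes>\<^sub>t m"

definition \<C> :: "'a psh \<Rightarrow> 'a set"
  where "\<C> H = {c\<in>Irr H. primitive H (frag_of c)}"

definition \<D> :: "'a psh \<Rightarrow> ('a, 'm) psh_mod \<Rightarrow> 'm set"
  where "\<D> H M = {d\<in>mIrr M. mod_primitive H M (frag_of d)}"

definition finsupp :: "'a set \<Rightarrow> ('a \<Rightarrow>\<^sub>0 nat) set"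
  where "finsupp C = {\<phi>. Poly_Mapping.keys \<phi> \<subseteq> C}"

definition mult_monoid :: "'a psh \<Rightarrow> ('a \<Rightarrow>\<^sub>0 int) monoid"
  where "mult_monoid H =
    \<lparr>carrier = tspan (Irr H), monoid.mult = (\<lambda>x y. hmult H (x \<otimes>\<^sub>t y)), one = hunit H 1\<rparr>"

text \<open>
  \<open>finprod\<close> is only meaningful in a commutative monoid; PSH-algebras are commutative, which is a
  theorem about \<open>psh_algebra\<close> and not one of its axioms.
\<close>

definition pi_prod :: "'a psh \<Rightarrow> ('a \<Rightarrow>\<^sub>0 nat) \<Rightarrow> ('a \<Rightarrow>\<^sub>0 int)"
  where "pi_prod H \<phi> =
    finprod (mult_monoid H) (\<lambda>c. frag_of c [^]\<^bsub>mult_monoid H\<^esub> poly_mapping.lookup \<phi> c)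
      (Poly_Mapping.keys \<phi>)"

definition pi_mod :: "'a psh \<Rightarrow> ('a, 'm) psh_mod \<Rightarrow> 'm \<Rightarrow> ('a \<Rightarrow>\<^sub>0 nat) \<Rightarrow> ('m \<Rightarrow>\<^sub>0 int)"
  where "pi_mod H M d \<phi> = act M (pi_prod H \<phi> \<otimes>\<^sub>t frag_of d)"

definition \<Omega>_alg :: "'a psh \<Rightarrow> ('a \<Rightarrow>\<^sub>0 nat) \<Rightarrow> 'a set"
  where "\<Omega>_alg H \<phi> = constituents (Irr H) (pi_prod H \<phi>)"

definition \<Omega>_mod :: "'a psh \<Rightarrow> ('a, 'm) psh_mod \<Rightarrow> 'm \<Rightarrow> ('a \<Rightarrow>\<^sub>0 nat) \<Rightarrow> 'm set"
  where "\<Omega>_mod H M d \<phi> = constituents (mIrr M) (pi_mod H M d \<phi>)"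

definition alg_part :: "'a psh \<Rightarrow> ('a \<Rightarrow>\<^sub>0 nat) \<Rightarrow> ('a \<Rightarrow>\<^sub>0 int) set"
  where "alg_part H \<phi> = tspan (\<Omega>_alg H \<phi>)"

definition mod_part :: "'a psh \<Rightarrow> ('a, 'm) psh_mod \<Rightarrow> 'm \<Rightarrow> ('a \<Rightarrow>\<^sub>0 nat) \<Rightarrow> ('m \<Rightarrow>\<^sub>0 int) set"
  where "mod_part H M d \<phi> = tspan (\<Omega>_mod H M d \<phi>)"

definition mod_comp :: "'a psh \<Rightarrow> ('a, 'm) psh_mod \<Rightarrow> 'm \<Rightarrow> ('m \<Rightarrow>\<^sub>0 int) set"
  where "mod_comp H M d = subgroup_sum (finsupp (\<C> H)) (mod_part H M d)"

text \<open>
  Decompositions of \<open>M\<close> as a direct sum of submodules each having a single primitive irreducible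
  element.  The summands are then nonzero, hence pairwise distinct, so that the decomposition is
  given by the set \<open>\<N>\<close> of its summands.
\<close>

definition single_primitive_decomposition ::
  "'a psh \<Rightarrow> ('a, 'm) psh_mod \<Rightarrow> ('m \<Rightarrow>\<^sub>0 int) set set \<Rightarrow> bool"
  where "single_primitive_decomposition H M \<N> \<longleftrightarrow>
    submodule_direct_sum H M \<N> (\<lambda>N. N) \<and> (\<forall>N\<in>\<N>. \<exists>!d. d \<in> \<D> H M \<and> frag_of d \<in> N)"

end

theory Submission
  imports Defs
begin

text \<open>
  Let \<open>c\<^sup>*\<close> be the operator on \<open>M\<close> adjoint to the action of a primitive irreducible \<open>c\<close>.  The Hopf axiom
  says that \<open>c'\<^sup>*(cm) = \<kappa> m + c c'\<^sup>*(m)\<close>, with \<open>\<kappa> = 0\<close> unless \<open>c' = c\<close>, while \<open>c\<^sup>*\<close> kills module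
  primitives.  Hence \<open>c\<^sup>*\<close> maps \<open>\<pi>\<^sub>\<phi> d\<close> to a multiple of \<open>\<pi>\<^sub>\<psi> d\<close> if \<open>\<phi> = \<psi> + c\<close>, and to \<open>0\<close> if
  \<open>\<phi>(c) = 0\<close>, so that the \<open>\<pi>\<^sub>\<phi> d\<close> are pairwise orthogonal.  Being positive, they have disjoint sets of
  constituents.  Conversely an irreducible element which is not primitive is a constituent of a product
  of irreducibles of smaller degree, whence by induction every irreducible is a constituent of some
  \<open>\<pi>\<^sub>\<phi> d\<close>.  The same argument applies to \<open>H\<close>, which is a \<open>1\<close>-PSH module over itself with \<open>1\<close> as its
  only module primitive irreducible.  Compatibility with the coaction is then adjoint to compatibility
  with the action.
\<close>

section \<open>T-groups\<close>

lemma form_eq_sum: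
  assumes "finite S" "Poly_Mapping.keys x \<subseteq> S"
  shows "form x y = (\<Sum>a\<in>S. poly_mapping.lookup x a * poly_mapping.lookup y a)"
  unfolding form_def
  by (rule sum.mono_neutral_left) (use assms in \<open>auto simp: in_keys_iff\<close>)

lemma form_frag_of_left [simp]: "form (frag_of a) y = poly_mapping.lookup y a"
  by (simp add: form_def)

lemma form_frag_of_right [simp]: "form x (frag_of a) = poly_mapping.lookup x a"
proof -
  have "form x (frag_of a) = (\<Sum>b\<in>insert a (Poly_Mapping.keys x). poly_mapping.lookup x b * (if b = a then 1 else 0))"
    by (subst form_eq_sum [of "insert a (Poly_Mapping.keys x)"]) (auto simp: lookup_frag_of)
  also have "\<dots> = poly_mapping.lookup x a"
    by (subst sum.remove [of _ a]) auto
  finally show ?thesis .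
qed

lemma form_commute: "form x y = form y x"
proof -
  let ?S = "Poly_Mapping.keys x \<union> Poly_Mapping.keys y"
  have "form x y = (\<Sum>a\<in>?S. poly_mapping.lookup x a * poly_mapping.lookup y a)"
    and "form y x = (\<Sum>a\<in>?S. poly_mapping.lookup y a * poly_mapping.lookup x a)"
    by (rule form_eq_sum; auto)+
  then show ?thesis
    by (simp add: mult.commute)
qed

lemma form_zero_right [simp]: "form x 0 = 0"
  by (simp add: form_def)

lemma form_diff_right: "form x (y - z) = form x y - form x z"
  by (simp add: form_def lookup_minus algebra_simps sum_subtractf)

lemma form_cmul_right: "form x (frag_cmul n y) = n * form x y"
  by (simp add: form_def sum_distrib_left algebra_simps)

lemma form_diff_left: "form (x - y) z = form x z - form y z"
  by (metis form_commute form_diff_right)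

text \<open>Positive definiteness, from a vanishing sum of squares. It turns a computation of inner
  products into an identity between elements.\<close>

lemma form_self_eq_0D:
  assumes "form x x = 0"
  shows "x = 0"
proof -
  have "\<forall>a\<in>Poly_Mapping.keys x. poly_mapping.lookup x a * poly_mapping.lookup x a = 0"
    using assms unfolding form_def by (subst sum_nonneg_eq_0_iff [symmetric]) auto
  then show ?thesis
    by (metis keys_eq_empty ex_in_conv in_keys_iff mult_eq_0_iff)
qed

text \<open>Outside \<open>\<Omega>\<close> the coefficients vanish, so nonnegativity may be
  required at every index.\<close>

lemma positive_iff:
  "positive \<Omega> x \<longleftrightarrow> Poly_Mapping.keys x \<subseteq> \<Omega> \<and> (\<forall>a. poly_mapping.lookup x a \<ge> 0)"
proof -
  have "poly_mapping.lookup x a \<ge> 0" if "Poly_Mapping.keys x \<subseteq> \<Omega>" "\<forall>\<omega>\<in>\<Omega>. poly_mapping.lookup x \<omega> \<ge> 0" for a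
    using that by (cases "a \<in> \<Omega>") (auto simp: in_keys_iff subset_iff, metis order_refl)
  then show ?thesis
    by (auto simp: positive_def)
qed

lemma positive_frag_of: "a \<in> \<Omega> \<Longrightarrow> positive \<Omega> (frag_of a)"
  by (simp add: positive_iff)

lemma constituents_positive:
  assumes "positive \<Omega> x"
  shows "constituents \<Omega> x = Poly_Mapping.keys x"
proof -
  have "poly_mapping.lookup x a > 0" if "a \<in> Poly_Mapping.keys x" for a
    using assms that by (metis in_keys_iff order_le_less positive_iff)
  then show ?thesis
    using assms by (auto simp: constituents_def positive_iff in_keys_iff)
qed

text \<open>For positive elements the form is a sum of nonnegative terms, and a vanishing sum leaves
  no common index in the supports. This is how orthogonality becomes disjointness of
  constituents.\<close>

lemma keys_disjoint_if_form_eq_0: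
  assumes "positive \<Omega> x" "positive \<Omega> y" "form x y = 0"
  shows "Poly_Mapping.keys x \<inter> Poly_Mapping.keys y = {}"
proof -
  have "\<forall>a\<in>Poly_Mapping.keys x. poly_mapping.lookup x a * poly_mapping.lookup y a = 0"
    using assms unfolding form_def positive_iff
    by (subst sum_nonneg_eq_0_iff [symmetric]) auto
  then show ?thesis
    by (auto simp: in_keys_iff)
qed

section \<open>Additive maps between free abelian groups and their supports\<close>

lemma hom_free_keys:
  assumes "f \<in> hom (free_Abelian_group A) (free_Abelian_group B)" "Poly_Mapping.keys x \<subseteq> A"
  shows "Poly_Mapping.keys (f x) \<subseteq> B"
  using hom_in_carrier [OF assms(1)] assms(2) by simp

lemma hom_free_zero:
  assumes "f \<in> hom (free_Abelian_group A) (free_Abelian_group B)"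
  shows "f 0 = 0"
  using hom_frag_diff [OF assms, of 0 0] by simp

text \<open>Membership in \<open>hom\<close> controls a map only on the carrier, hence the
  hypothesis on the support. On the carrier the values at the basis determine the map, which reduces
  later support statements to irreducible elements.\<close>

lemma hom_free_eq_frag_extend:
  assumes f: "f \<in> hom (free_Abelian_group A) (free_Abelian_group B)" and x: "Poly_Mapping.keys x \<subseteq> A"
  shows "f x = frag_extend (\<lambda>a. f (frag_of a)) x"
  using x
proof (induction x rule: free_Abelian_group_induct [consumes 1])
  case 1
  then show ?case
    by (simp add: hom_free_zero [OF f])
next
  case (2 x y)
  then show ?case
    by (simp add: hom_frag_diff [OF f] frag_extend_diff)
qed simp

lemma hom_free_cmul:
  assumes f: "f \<in> hom (free_Abelian_group A) (free_Abelian_group B)" and x: "Poly_Mapping.keys x \<subseteq> A"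
  shows "f (frag_cmul n x) = frag_cmul n (f x)"
proof -
  have "Poly_Mapping.keys (frag_cmul n x) \<subseteq> A"
    using x keys_cmul by blast
  then show ?thesis
    by (simp only: hom_free_eq_frag_extend [OF f] x frag_extend_cmul)
qed

lemma hom_free_keys_image:
  assumes f: "f \<in> hom (free_Abelian_group A) (free_Abelian_group B)" and x: "Poly_Mapping.keys x \<subseteq> A"
    and "\<And>a. a \<in> Poly_Mapping.keys x \<Longrightarrow> Poly_Mapping.keys (f (frag_of a)) \<subseteq> C"
  shows "Poly_Mapping.keys (f x) \<subseteq> C"
  using assms(3) keys_frag_extend [of "\<lambda>a. f (frag_of a)" x]
  unfolding hom_free_eq_frag_extend [OF f x] by blast

lemma keys_frag_extend_subset:
  assumes "\<And>a. a \<in> Poly_Mapping.keys x \<Longrightarrow> Poly_Mapping.keys (f a) \<subseteq> C"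
  shows "Poly_Mapping.keys (frag_extend f x) \<subseteq> C"
  using assms keys_frag_extend [of f x] by blast

lemma positive_map_lookup_mono:
  assumes f: "f \<in> hom (free_Abelian_group A) (free_Abelian_group B)" and pos: "positive_map A B f"
    and xy: "positive A x" "positive A y"
    and le: "\<And>a. poly_mapping.lookup x a \<le> poly_mapping.lookup y a"
  shows "poly_mapping.lookup (f x) b \<le> poly_mapping.lookup (f y) b"
proof -
  have k: "Poly_Mapping.keys x \<subseteq> A" "Poly_Mapping.keys y \<subseteq> A"
    using xy by (auto simp: positive_iff)
  then have "positive A (y - x)"
    using le by (auto simp: positive_iff lookup_minus dest!: subsetD [OF keys_diff])
  then have "poly_mapping.lookup (f (y - x)) b \<ge> 0"
    using pos by (simp add: positive_map_def positive_iff)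
  then show ?thesis
    using hom_frag_diff [OF f k(2,1)] by (simp add: lookup_minus)
qed

text \<open>No cancellation: \<open>x\<close> dominates \<open>frag_of a\<close> coefficientwise, so
  \<open>f x\<close> dominates \<open>f (frag_of a)\<close>.\<close>

lemma positive_map_in_keys:
  assumes f: "f \<in> hom (free_Abelian_group A) (free_Abelian_group B)" "positive_map A B f"
    and x: "positive A x" and a: "a \<in> Poly_Mapping.keys x"
    and b: "b \<in> Poly_Mapping.keys (f (frag_of a))"
  shows "b \<in> Poly_Mapping.keys (f x)"
proof -
  have aA: "a \<in> A"
    using x a by (auto simp: positive_iff)
  have "positive A (frag_of a)"
    using aA by (rule positive_frag_of)
  \<comment> \<open>A nonzero nonnegative integer coefficient is at least 1.\<close>
  moreover have "poly_mapping.lookup (frag_of a) a' \<le> poly_mapping.lookup x a'" for a'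
  proof -
    have "poly_mapping.lookup x a \<noteq> 0" "poly_mapping.lookup x a \<ge> 0" "poly_mapping.lookup x a' \<ge> 0"
      using x a by (auto simp: positive_iff in_keys_iff)
    then show ?thesis
      by auto
  qed
  ultimately have "poly_mapping.lookup (f (frag_of a)) b \<le> poly_mapping.lookup (f x) b"
    using positive_map_lookup_mono [OF f _ x] by blast
  moreover have "poly_mapping.lookup (f (frag_of a)) b > 0"
    using f(2) \<open>positive A (frag_of a)\<close> b
    by (metis in_keys_iff order_le_less positive_iff positive_map_def)
  ultimately show ?thesis
    by (simp add: in_keys_iff)
qed

section \<open>Pure tensors in coordinates\<close>

lemma tensor_frag_of [simp]: "frag_of a \<otimes>\<^sub>t frag_of b = frag_of (a, b)"
  by (simp add: tensor_def)

lemma tensor_zero_left [simp]: "0 \<otimes>\<^sub>t y = 0"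
  by (simp add: tensor_def)

lemma tensor_add_left: "(x + x') \<otimes>\<^sub>t y = x \<otimes>\<^sub>t y + x' \<otimes>\<^sub>t y"
  by (simp add: tensor_def frag_extend_add)

lemma tensor_diff_left: "(x - x') \<otimes>\<^sub>t y = x \<otimes>\<^sub>t y - x' \<otimes>\<^sub>t y"
  by (simp add: tensor_def frag_extend_diff)

lemma tensor_cmul_left: "frag_cmul n x \<otimes>\<^sub>t y = frag_cmul n (x \<otimes>\<^sub>t y)"
  by (simp add: tensor_def frag_extend_cmul)

lemma lookup_tensor [simp]:
  "poly_mapping.lookup (x \<otimes>\<^sub>t y) (a, b) = poly_mapping.lookup x a * poly_mapping.lookup y b"
  using subset_UNIV
proof (induction x rule: frag_induction)
  case (one a')
  show ?case
    using subset_UNIV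
    by (induction y rule: frag_induction)
       (auto simp: tensor_def frag_extend_diff lookup_minus algebra_simps)
qed (auto simp: tensor_diff_left lookup_minus algebra_simps)

lemma tensor_diff_right: "x \<otimes>\<^sub>t (y - y') = x \<otimes>\<^sub>t y - x \<otimes>\<^sub>t y'"
  by (rule poly_mapping_eqI) (auto simp: lookup_minus algebra_simps)

lemma tensor_zero_right [simp]: "x \<otimes>\<^sub>t 0 = 0"
  by (rule poly_mapping_eqI) auto

lemma tensor_cmul_right: "x \<otimes>\<^sub>t frag_cmul n y = frag_cmul n (x \<otimes>\<^sub>t y)"
  by (rule poly_mapping_eqI) auto

lemma keys_tensor [simp]: "Poly_Mapping.keys (x \<otimes>\<^sub>t y) = Poly_Mapping.keys x \<times> Poly_Mapping.keys y"
  by (auto simp: in_keys_iff)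

lemma positive_tensor: "positive A x \<Longrightarrow> positive B y \<Longrightarrow> positive (A \<times> B) (x \<otimes>\<^sub>t y)"
  by (auto simp: positive_iff)

text \<open>Contracting the left factor against \<open>a\<close> is adjoint to tensoring with
  \<open>a\<close> on the left. Combined with the adjointness of action and coaction, this gives
  \<open>form_raise\<close>.\<close>

lemma form_tensor_frag_of:
  "form (frag_of a \<otimes>\<^sub>t x) y = form x (contract_left (\<lambda>z. poly_mapping.lookup z a) y)"
  using subset_UNIV
proof (induction y rule: frag_induction)
  case (one p)
  then show ?case
    by (cases p) (auto simp: contract_left_def form_cmul_right lookup_single)
qed (auto simp: contract_left_def frag_extend_diff form_diff_right)

section \<open>Spans of irreducible elements and direct sums\<close>

lemma subgroup_tspan: "subgroup (tspan A) (free_Abelian_group UNIV)"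
proof (rule group.subgroupI)
  have "0 \<in> tspan A"
    by simp
  then show "tspan A \<noteq> {}"
    by blast
qed (auto dest: subsetD [OF keys_add])

lemma tspan_mono: "A \<subseteq> B \<Longrightarrow> tspan A \<subseteq> tspan B"
  by auto

lemma generate_tspan_eqI:
  assumes "S \<subseteq> tspan A" "\<And>a. a \<in> A \<Longrightarrow> frag_of a \<in> S"
  shows "generate (free_Abelian_group UNIV) S = tspan A"
proof
  show "generate (free_Abelian_group UNIV) S \<subseteq> tspan A"
    by (rule group.generate_subgroup_incl) (use assms(1) subgroup_tspan in auto)
  have "x \<in> generate (free_Abelian_group UNIV) S" if "Poly_Mapping.keys x \<subseteq> A" for x
    using that
  proof (induction x rule: free_Abelian_group_induct [consumes 1])
    case 1
    show ?case
      using generate.one [of "free_Abelian_group UNIV" S] by simp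
  next
    case (2 x y)
    have "x \<otimes>\<^bsub>free_Abelian_group UNIV\<^esub> inv\<^bsub>free_Abelian_group UNIV\<^esub> y \<in> generate (free_Abelian_group UNIV) S"
      by (rule generate.eng [OF 2(3) group.generate_m_inv_closed [OF _ _ 2(4)]]) auto
    then show ?case
      by simp
  next
    case (3 a)
    then show ?case
      by (simp add: assms(2) generate.incl)
  qed
  then show "tspan A \<subseteq> generate (free_Abelian_group UNIV) S"
    by auto
qed

lemma tspan_tensor_tspan: "tspan A \<otimes>\<^sub>s tspan B = tspan (A \<times> B)"
  unfolding subgroup_tensor_def
proof (rule generate_tspan_eqI)
  show "frag_of p \<in> {x \<otimes>\<^sub>t y |x y. x \<in> tspan A \<and> y \<in> tspan B}" if "p \<in> A \<times> B" for p
    using that by (auto intro!: exI [of _ "frag_of (fst p)"] exI [of _ "frag_of (snd p)"])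
qed auto

lemma subgroup_sum_tspan: "subgroup_sum I (\<lambda>i. tspan (S i)) = tspan (\<Union>i\<in>I. S i)"
  unfolding subgroup_sum_def by (rule generate_tspan_eqI) (auto simp: subset_iff)

text \<open>Only indices in \<open>I\<close> matter, so a family known to consist of spans only on
  \<open>I\<close> can be replaced by these spans.\<close>

lemma sum_group_cong:
  assumes "\<And>i. i \<in> I \<Longrightarrow> G i = G' i"
  shows "sum_group I G = sum_group I G'"
proof -
  have "product_group I G = product_group I G'"
    using assms by (auto simp: product_group_def fun_eq_iff restrict_def intro!: PiE_cong)
  moreover have "(\<Pi>\<^sub>E i\<in>I. carrier (G i)) = (\<Pi>\<^sub>E i\<in>I. carrier (G' i))"
    using assms by (intro PiE_cong) simp
  moreover have "{i \<in> I. x i \<noteq> \<one>\<^bsub>G i\<^esub>} = {i \<in> I. x i \<noteq> \<one>\<^bsub>G' i\<^esub>}" for x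
    using assms by auto
  ultimately show ?thesis
    by (simp add: sum_group_def)
qed

lemma is_direct_sum_tspan:
  assumes "disjoint_family_on S I" and N: "\<And>i. i \<in> I \<Longrightarrow> N i = tspan (S i)"
  shows "is_direct_sum (tspan (\<Union>i\<in>I. S i)) I N"
proof -
  \<comment> \<open>Cutting the carrier of the full group down to a span gives the free abelian
    group on the smaller basis, whose direct sums over disjoint bases are known.\<close>
  have eq: "(free_Abelian_group UNIV)\<lparr>carrier := tspan A\<rparr> = free_Abelian_group A" for A :: "'b set"
    by (simp add: free_Abelian_group_def)
  have "pairwise (\<lambda>i j. disjnt (S i) (S j)) I"
    using assms by (auto simp: pairwise_def disjnt_def disjoint_family_on_def)
  from iso_free_Abelian_group_sum [OF this]
  have "(\<lambda>f. sum' f I) \<in> iso (sum_group I (\<lambda>i. (free_Abelian_group UNIV)\<lparr>carrier := tspan (S i)\<rparr>))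
      ((free_Abelian_group UNIV)\<lparr>carrier := tspan (\<Union>i\<in>I. S i)\<rparr>)"
    by (simp only: eq)
  moreover have "sum_group I (\<lambda>i. (free_Abelian_group UNIV)\<lparr>carrier := N i\<rparr>) =
      sum_group I (\<lambda>i. (free_Abelian_group UNIV)\<lparr>carrier := tspan (S i)\<rparr>)"
    by (rule sum_group_cong) (simp only: N)
  ultimately show ?thesis
    by (simp only: is_direct_sum_def)
qed

lemma irreducibles_in_tspan: "S \<subseteq> \<Omega> \<Longrightarrow> irreducibles_in \<Omega> (tspan S) = S"
  by (auto simp: irreducibles_in_def)

lemma tgroup_direct_sum_tspan:
  assumes disj: "disjoint_family_on S I" and un: "(\<Union>i\<in>I. S i) = \<Omega>"
    and N: "\<And>i. i \<in> I \<Longrightarrow> N i = tspan (S i)"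
  shows "tgroup_direct_sum \<Omega> I N"
proof -
  have irr: "irreducibles_in \<Omega> (N i) = S i" if "i \<in> I" for i
    unfolding N [OF that] using un that by (intro irreducibles_in_tspan) auto
  have "is_direct_sum (tspan \<Omega>) I N"
    using is_direct_sum_tspan [OF disj N] un by simp
  moreover have "disjoint_family_on (\<lambda>i. irreducibles_in \<Omega> (N i)) I"
    using disj irr by (simp add: disjoint_family_on_def)
  moreover have "(\<Union>i\<in>I. irreducibles_in \<Omega> (N i)) = \<Omega>"
    using un irr by simp
  moreover have "\<forall>i\<in>I. N i = tspan (irreducibles_in \<Omega> (N i))"
    by (intro ballI) (simp only: irr, rule N)
  ultimately show ?thesis
    unfolding tgroup_direct_sum_def by (intro conjI)
qed

section \<open>Contractions, tensor products of maps and the middle swap\<close>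

lemma lookup_contract_left:
  "poly_mapping.lookup (contract_left (\<lambda>z. poly_mapping.lookup z a) y) b = poly_mapping.lookup y (a, b)"
  using form_tensor_frag_of [of a "frag_of b" y] by simp

lemma lookup_contract_right:
  "poly_mapping.lookup (contract_right (\<lambda>z. poly_mapping.lookup z b) y) a = poly_mapping.lookup y (a, b)"
  using subset_UNIV
proof (induction y rule: frag_induction)
  case (one p)
  then show ?case
    by (cases p) (auto simp: contract_right_def)
qed (auto simp: contract_right_def frag_extend_diff lookup_minus)

lemma contract_left_diff: "contract_left \<epsilon> (x - y) = contract_left \<epsilon> x - contract_left \<epsilon> y"
  by (simp add: contract_left_def frag_extend_diff)

lemma contract_left_add: "contract_left \<epsilon> (x + y) = contract_left \<epsilon> x + contract_left \<epsilon> y"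
  by (simp add: contract_left_def frag_extend_add)

lemma contract_left_cmul: "contract_left \<epsilon> (frag_cmul n x) = frag_cmul n (contract_left \<epsilon> x)"
  by (simp add: contract_left_def frag_extend_cmul)

lemma contract_left_zero [simp]: "contract_left \<epsilon> 0 = 0"
  by (simp add: contract_left_def)

lemma contract_left_tensor_frag_of:
  "contract_left (\<lambda>z. poly_mapping.lookup z a) (x \<otimes>\<^sub>t y) = frag_cmul (poly_mapping.lookup x a) y"
  by (rule poly_mapping_eqI) (simp add: lookup_contract_left)

lemma keys_contract_left:
  "Poly_Mapping.keys x \<subseteq> A \<times> B \<Longrightarrow> Poly_Mapping.keys (contract_left \<epsilon> x) \<subseteq> B"
  unfolding contract_left_def by (rule keys_frag_extend_subset) auto

lemma tensor_map_frag_of [simp]: "tensor_map f g (frag_of (a, b)) = f (frag_of a) \<otimes>\<^sub>t g (frag_of b)"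
  by (simp add: tensor_map_def)

lemma tensor_map_add: "tensor_map f g (x + y) = tensor_map f g x + tensor_map f g y"
  by (simp add: tensor_map_def frag_extend_add)

lemma tensor_map_diff: "tensor_map f g (x - y) = tensor_map f g x - tensor_map f g y"
  by (simp add: tensor_map_def frag_extend_diff)

lemma tensor_map_cmul: "tensor_map f g (frag_cmul n x) = frag_cmul n (tensor_map f g x)"
  by (simp add: tensor_map_def frag_extend_cmul)

lemma tensor_map_zero [simp]: "tensor_map f g 0 = 0"
  by (simp add: tensor_map_def)

lemma tensor_map_id [simp]: "tensor_map id id x = x"
  using subset_UNIV
  by (induction x rule: frag_induction) (auto simp: tensor_map_def frag_extend_diff)

lemma middle_swap_frag_of [simp]: "middle_swap (frag_of ((a, b), (c, d))) = frag_of ((a, c), (b, d))"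
  by (simp add: middle_swap_def)

lemma middle_swap_add: "middle_swap (x + y) = middle_swap x + middle_swap y"
  by (simp add: middle_swap_def frag_extend_add)

lemma middle_swap_diff: "middle_swap (x - y) = middle_swap x - middle_swap y"
  by (simp add: middle_swap_def frag_extend_diff)

lemma middle_swap_cmul: "middle_swap (frag_cmul n x) = frag_cmul n (middle_swap x)"
  by (simp add: middle_swap_def frag_extend_cmul)

lemma middle_swap_zero [simp]: "middle_swap 0 = 0"
  by (simp add: middle_swap_def)

section \<open>PSH-algebras\<close>

text \<open>The description is justified by \<open>unit_one_irreducible\<close>.\<close>

definition unit_irr :: "'a psh \<Rightarrow> 'a"
  where "unit_irr H = (THE u. hunit H 1 = frag_of u)"

context psh_algebra
begin

section \<open>The unit as the irreducible element of degree zero\<close>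

lemma unit_keys: "Poly_Mapping.keys (hunit H n) \<subseteq> {\<omega>\<in>Irr H. Deg H \<omega> = 0}"
  using unit_graded [of n] by (simp add: homogeneous_def)

lemma lookup_unit: "a \<in> Irr H \<Longrightarrow> poly_mapping.lookup (hunit H n) a = n * hcounit H (frag_of a)"
  using unit_counit_adjoint [of "frag_of a" n] by simp

lemma unit_eq_cmul: "hunit H n = frag_cmul n (hunit H 1)"
proof (rule poly_mapping_eqI)
  fix a
  show "poly_mapping.lookup (hunit H n) a = poly_mapping.lookup (frag_cmul n (hunit H 1)) a"
  proof (cases "a \<in> Irr H")
    case False
    then have "a \<notin> Poly_Mapping.keys (hunit H n)" "a \<notin> Poly_Mapping.keys (hunit H 1)"
      using unit_keys by blast+
    then show ?thesis
      by (simp add: in_keys_iff)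
  qed (simp add: lookup_unit)
qed

text \<open>An irreducible \<open>u\<close> in the support of 1 has degree 0, so connectedness gives
  \<open>u = n 1\<close> with \<open>n\<close> the counit of \<open>u\<close>. By adjointness
  \<open>n\<close> is also the coefficient of \<open>u\<close> in 1. Comparing coefficients of
  \<open>u\<close> gives \<open>n * n = 1\<close>, and positivity excludes -1.\<close>

lemma unit_one_irreducible: "\<exists>u. hunit H 1 = frag_of u"
proof -
  have "hunit H 1 \<noteq> 0"
    using counit_unit [of 0] counit_unit [of 1] unit_eq_cmul [of 0] by auto
  then obtain u where u: "u \<in> Poly_Mapping.keys (hunit H 1)"
    by (meson keys_eq_empty ex_in_conv)
  then have uI: "u \<in> Irr H" "Deg H u = 0"
    using unit_keys by blast+
  define n where "n = poly_mapping.lookup (hunit H 1) u"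
  have n: "n = hcounit H (frag_of u)"
    by (simp add: n_def lookup_unit uI)
  have "frag_of u = frag_cmul n (hunit H 1)"
    using unit_counit [of "frag_of u"] uI n unit_eq_cmul [of n] by (simp add: homogeneous_def)
  then have "poly_mapping.lookup (frag_of u) u = n * n"
    by (metis lookup_frag_cmul n_def)
  then have "n * n = 1"
    by simp
  moreover have "n \<ge> 0"
    using unit_positive [of 1] by (simp add: positive_iff n_def)
  ultimately have "n = 1"
    using pos_zmult_eq_1_iff_lemma by force
  then have "hunit H 1 = frag_of u"
    using \<open>frag_of u = _\<close> by simp
  then show ?thesis ..
qed

lemma unit_one: "hunit H 1 = frag_of (unit_irr H)"
  unfolding unit_irr_def by (rule theI') (use unit_one_irreducible in \<open>auto simp: frag_of_eq\<close>)

lemma unit_irr_in_Irr [simp]: "unit_irr H \<in> Irr H"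
  using unit_keys [of 1] by (simp add: unit_one)

lemma unit_eq: "hunit H n = frag_cmul n (frag_of (unit_irr H))"
  using unit_eq_cmul unit_one by simp

lemma counit_frag_of:
  "a \<in> Irr H \<Longrightarrow> hcounit H (frag_of a) = poly_mapping.lookup (frag_of a) (unit_irr H)"
  using lookup_unit [of a 1] by (auto simp: unit_one)

text \<open>Connectedness in terms of irreducible elements. It makes the inductions on degree
  decrease strictly once a factor 1 is excluded.\<close>

lemma Deg_eq_0_iff:
  assumes "a \<in> Irr H"
  shows "Deg H a = 0 \<longleftrightarrow> a = unit_irr H"
proof
  assume "Deg H a = 0"
  then have "hunit H (hcounit H (frag_of a)) = frag_of a"
    using assms by (intro unit_counit) (simp add: homogeneous_def)
  then show "a = unit_irr H"
    using assms by (auto simp: unit_eq counit_frag_of frag_of_eq split: if_splits)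
next
  assume "a = unit_irr H"
  then show "Deg H a = 0"
    using unit_keys [of 1] by (simp add: unit_one)
qed

text \<open>The counit is the coefficient functional of \<open>unit_irr H\<close>, because it is
  adjoint to the unit. The counit axioms thus become statements about coefficients.\<close>

lemma contract_left_counit:
  assumes "Poly_Mapping.keys x \<subseteq> Irr H \<times> B"
  shows "contract_left (hcounit H) x = contract_left (\<lambda>z. poly_mapping.lookup z (unit_irr H)) x"
  unfolding contract_left_def
proof (rule frag_extend_eq)
  fix p assume "p \<in> Poly_Mapping.keys x"
  then show "(case p of (a, b) \<Rightarrow> frag_cmul (hcounit H (frag_of a)) (frag_of b)) =
      (case p of (a, b) \<Rightarrow> frag_cmul (poly_mapping.lookup (frag_of a) (unit_irr H)) (frag_of b))"
    using assms by (cases p) (auto simp: counit_frag_of)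
qed

lemma contract_right_counit:
  assumes "Poly_Mapping.keys x \<subseteq> B \<times> Irr H"
  shows "contract_right (hcounit H) x = contract_right (\<lambda>z. poly_mapping.lookup z (unit_irr H)) x"
  unfolding contract_right_def
proof (rule frag_extend_eq)
  fix p assume "p \<in> Poly_Mapping.keys x"
  then show "(case p of (a, b) \<Rightarrow> frag_cmul (hcounit H (frag_of b)) (frag_of a)) =
      (case p of (a, b) \<Rightarrow> frag_cmul (poly_mapping.lookup (frag_of b) (unit_irr H)) (frag_of a))"
    using assms by (cases p) (auto simp: counit_frag_of)
qed

lemma comult_keys: "Poly_Mapping.keys x \<subseteq> Irr H \<Longrightarrow> Poly_Mapping.keys (hcomult H x) \<subseteq> Irr H \<times> Irr H"
  by (rule hom_free_keys [OF comult_hom])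

lemma mult_keys: "Poly_Mapping.keys x \<subseteq> Irr H \<times> Irr H \<Longrightarrow> Poly_Mapping.keys (hmult H x) \<subseteq> Irr H"
  by (rule hom_free_keys [OF mult_hom])

lemma lookup_comult_unit_left:
  assumes "Poly_Mapping.keys x \<subseteq> Irr H"
  shows "poly_mapping.lookup (hcomult H x) (unit_irr H, b) = poly_mapping.lookup x b"
  using counit_left [of x] assms comult_keys [OF assms]
  by (metis carrier_free_Abelian_group_iff contract_left_counit lookup_contract_left)

lemma lookup_comult_unit_right:
  assumes "Poly_Mapping.keys x \<subseteq> Irr H"
  shows "poly_mapping.lookup (hcomult H x) (a, unit_irr H) = poly_mapping.lookup x a"
  using counit_right [of x] assms comult_keys [OF assms]
  by (metis carrier_free_Abelian_group_iff contract_right_counit lookup_contract_right)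

lemma comult_unit_irr: "hcomult H (frag_of (unit_irr H)) = frag_of (unit_irr H, unit_irr H)"
  using comult_one by (simp add: unit_one)

lemma mult_unit_irr_left [simp]:
  "Poly_Mapping.keys x \<subseteq> Irr H \<Longrightarrow> hmult H (frag_of (unit_irr H) \<otimes>\<^sub>t x) = x"
  using unit_left by (simp add: unit_one)

lemma mult_unit_irr_right [simp]:
  "Poly_Mapping.keys x \<subseteq> Irr H \<Longrightarrow> hmult H (x \<otimes>\<^sub>t frag_of (unit_irr H)) = x"
  using unit_right by (simp add: unit_one)

lemma mult_frag_of_unit_irr [simp]:
  assumes "a \<in> Irr H"
  shows "hmult H (frag_of (unit_irr H, a)) = frag_of a" "hmult H (frag_of (a, unit_irr H)) = frag_of a"
  using mult_unit_irr_left [of "frag_of a"] mult_unit_irr_right [of "frag_of a"] assms by simp_all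

section \<open>Primitive elements and the maps \<open>Psi\<close>\<close>

lemma primitive_in_Irr: "c \<in> \<C> H \<Longrightarrow> c \<in> Irr H"
  by (simp add: \<C>_def)

lemma comult_primitive:
  "c \<in> \<C> H \<Longrightarrow> hcomult H (frag_of c) = frag_of (c, unit_irr H) + frag_of (unit_irr H, c)"
  by (simp add: \<C>_def primitive_def unit_one)

text \<open>The comultiplication of 1 is the single tensor of 1 with itself. Were 1 primitive, that
  tensor would have coefficient 2.\<close>

lemma primitive_neq_unit:
  assumes "c \<in> \<C> H"
  shows "c \<noteq> unit_irr H"
proof
  assume "c = unit_irr H"
  then have "poly_mapping.lookup (frag_of (c, c)) (c, c) =
      poly_mapping.lookup (frag_of (c, c) + frag_of (c, c)) (c, c)"
    using comult_primitive [OF assms] comult_unit_irr by simp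
  then show False
    by (simp add: lookup_add)
qed

text \<open>The index \<open>n\<close> stands for \<open>n + 1\<close> tensor factors, hence words
  of length \<open>Suc n\<close>.\<close>

lemma iter_comult_unit_irr:
  "iter_comult H n (frag_of (unit_irr H)) = frag_of (replicate (Suc n) (unit_irr H))"
  by (induction n) (simp_all add: comult_unit_irr)

lemma iter_mult_unit_irr:
  "iter_mult H n (frag_of (replicate (Suc n) (unit_irr H))) = frag_of (unit_irr H)"
  by (induction n) (simp_all add: tensor_map_def)

lemma Psi_unit_irr: "Psi H k (frag_of (unit_irr H)) = frag_of (unit_irr H)"
proof (cases k)
  case 0
  then show ?thesis
    by (simp add: counit_frag_of unit_eq)
next
  case (Suc n)
  then show ?thesis
    by (simp only: Psi.simps comp_apply iter_comult_unit_irr iter_mult_unit_irr)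
qed

text \<open>The witness \<open>W\<close> consists of the words with one letter \<open>c\<close> and \<open>n\<close> letters \<open>1\<close>.\<close>

lemma iter_mult_comult_primitive:
  assumes c: "c \<in> \<C> H"
  shows "\<exists>W. Poly_Mapping.keys (iter_comult H n (frag_of c)) \<subseteq> W \<and>
    (\<forall>x. Poly_Mapping.keys x \<subseteq> W \<longrightarrow> Poly_Mapping.keys (iter_mult H n x) \<subseteq> {c})"
proof (induction n)
  case 0
  show ?case
    by (rule exI [of _ "{[c]}"]) (auto intro!: keys_frag_extend_subset simp del: subset_singleton_iff)
next
  case (Suc n)
  then obtain W where
    W: "Poly_Mapping.keys (iter_comult H n (frag_of c)) \<subseteq> W"
      "\<And>x. Poly_Mapping.keys x \<subseteq> W \<Longrightarrow> Poly_Mapping.keys (iter_mult H n x) \<subseteq> {c}"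
    by blast
  let ?u = "unit_irr H"
  let ?us = "replicate (Suc n) ?u"
  \<comment> \<open>The two summands of the comultiplication of \<open>c\<close>: either
    \<open>c\<close> comes first and only ones follow, or 1 comes first and a word of the smaller
    witness follows.\<close>
  let ?W = "insert (c # ?us) ((#) ?u ` W)"
  show ?case
  proof (intro exI conjI allI impI)
    have "Poly_Mapping.keys (tensor_map id (iter_comult H n) (hcomult H (frag_of c))) \<subseteq> insert (c, ?us) ({?u} \<times> W)"
      using W(1) keys_add [of "frag_of (c, ?us)" "frag_of ?u \<otimes>\<^sub>t iter_comult H n (frag_of c)"]
      by (auto simp: comult_primitive [OF c] tensor_map_add iter_comult_unit_irr simp del: replicate_Suc)
    then show "Poly_Mapping.keys (iter_comult H (Suc n) (frag_of c)) \<subseteq> ?W"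
      by (auto simp del: replicate_Suc intro!: keys_frag_extend_subset)
  next
    fix x :: "'a list \<Rightarrow>\<^sub>0 int"
    assume x: "Poly_Mapping.keys x \<subseteq> ?W"
    have W': "Poly_Mapping.keys (iter_mult H n (frag_of w)) \<subseteq> {c}" if "w \<in> W" for w
      using W(2) [of "frag_of w"] that by simp
    let ?y = "frag_extend (\<lambda>as. frag_of (hd as, tl as)) x"
    have "Poly_Mapping.keys ?y \<subseteq> insert (c, ?us) ({?u} \<times> W)"
      by (rule keys_frag_extend_subset) (use x in auto)
    \<comment> \<open>Multiplying all letters but the first leaves only \<open>c\<close> times 1 and
      1 times \<open>c\<close>, both of which are \<open>c\<close>.\<close>
    let ?t = "tensor_map id (iter_mult H n) ?y"
    have t: "Poly_Mapping.keys ?t \<subseteq> {(c, ?u), (?u, c)}" (is "_ \<subseteq> ?P")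
      unfolding tensor_map_def
    proof (intro keys_frag_extend_subset)
      fix p assume "p \<in> Poly_Mapping.keys ?y"
      with \<open>Poly_Mapping.keys ?y \<subseteq> _\<close>
      consider "p = (c, ?us)" | w where "p = (?u, w)" "w \<in> W"
        by blast
      then show "Poly_Mapping.keys (case p of (a, b) \<Rightarrow> id (frag_of a) \<otimes>\<^sub>t iter_mult H n (frag_of b)) \<subseteq> ?P"
      proof cases
        case 1
        then show ?thesis
          by (simp add: iter_mult_unit_irr del: replicate_Suc)
      next
        case 2
        then have "Poly_Mapping.keys (case p of (a, b) \<Rightarrow> id (frag_of a) \<otimes>\<^sub>t iter_mult H n (frag_of b)) =
            {?u} \<times> Poly_Mapping.keys (iter_mult H n (frag_of w))"
          by simp
        with W' [OF 2(2)] show ?thesis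
          by blast
      qed
    qed
    have "Poly_Mapping.keys (hmult H ?t) \<subseteq> {c}"
    proof (rule hom_free_keys_image [OF mult_hom])
      have "?P \<subseteq> Irr H \<times> Irr H"
        using primitive_in_Irr [OF c] by simp
      with t show "Poly_Mapping.keys ?t \<subseteq> Irr H \<times> Irr H"
        by (rule order_trans)
      fix p assume "p \<in> Poly_Mapping.keys ?t"
      with t have "p \<in> ?P"
        by (rule subsetD)
      then show "Poly_Mapping.keys (hmult H (frag_of p)) \<subseteq> {c}"
        using primitive_in_Irr [OF c] by (elim insertE emptyE) simp_all
    qed
    then show "Poly_Mapping.keys (iter_mult H (Suc n) x) \<subseteq> {c}"
      by simp
  qed
qed

text \<open>The words in the iterated comultiplication of \<open>c\<close> all multiply back to
  multiples of \<open>c\<close>. For \<open>k = 0\<close> the scalar is 0, since the counit kills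
  \<open>c\<close>.\<close>

lemma Psi_primitive:
  assumes c: "c \<in> \<C> H"
  obtains n where "Psi H k (frag_of c) = frag_cmul n (frag_of c)"
proof -
  have k: "Poly_Mapping.keys (Psi H k (frag_of c)) \<subseteq> {c}"
  proof (cases k)
    case 0
    then show ?thesis
      using c primitive_neq_unit [OF c] primitive_in_Irr [OF c] by (simp add: counit_frag_of unit_eq)
  next
    case (Suc n)
    then show ?thesis
      using iter_mult_comult_primitive [OF c, of n] by auto
  qed
  have "Psi H k (frag_of c) = frag_cmul (poly_mapping.lookup (Psi H k (frag_of c)) c) (frag_of c)"
    by (rule poly_mapping_eqI) (use k in \<open>auto simp: in_keys_iff subset_iff\<close>)
  then show thesis
    by (rule that)
qed

end

section \<open>PSH modules\<close>

context psh_module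
begin

section \<open>Raising and lowering operators\<close>

abbreviation raise :: "'a \<Rightarrow> ('m \<Rightarrow>\<^sub>0 int) \<Rightarrow> ('m \<Rightarrow>\<^sub>0 int)"
  where "raise a m \<equiv> act M (frag_of a \<otimes>\<^sub>t m)"

text \<open>The adjoint of the action of \<open>a\<close>, as \<open>form_raise\<close> shows: the
  part of the coaction whose left factor is \<open>a\<close>.\<close>

definition lower :: "'a \<Rightarrow> ('m \<Rightarrow>\<^sub>0 int) \<Rightarrow> ('m \<Rightarrow>\<^sub>0 int)"
  where "lower a m = contract_left (\<lambda>z. poly_mapping.lookup z a) (coact M m)"

lemma coact_keys:
  "Poly_Mapping.keys m \<subseteq> mIrr M \<Longrightarrow> Poly_Mapping.keys (coact M m) \<subseteq> Irr H \<times> mIrr M"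
  by (rule hom_free_keys [OF coact_hom])

lemma lookup_lower: "poly_mapping.lookup (lower a m) b = poly_mapping.lookup (coact M m) (a, b)"
  by (simp add: lower_def lookup_contract_left)

lemma form_raise:
  assumes "a \<in> Irr H" "Poly_Mapping.keys m \<subseteq> mIrr M" "Poly_Mapping.keys y \<subseteq> mIrr M"
  shows "form (raise a m) y = form m (lower a y)"
proof -
  have "form (raise a m) y = form (frag_of a \<otimes>\<^sub>t m) (coact M y)"
    using act_coact_adjoint [unfolded adjoint_maps_def, rule_format, of "frag_of a \<otimes>\<^sub>t m" y] assms
    by auto
  then show ?thesis
    by (simp add: lower_def form_tensor_frag_of)
qed

text \<open>Adjointness read on bases: action and coaction have the same structure
  constants.\<close>

lemma lookup_act_frag_of:
  assumes "a \<in> Irr H" "b \<in> mIrr M" "\<omega> \<in> mIrr M"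
  shows "poly_mapping.lookup (act M (frag_of (a, b))) \<omega> = poly_mapping.lookup (coact M (frag_of \<omega>)) (a, b)"
  using form_raise [of a "frag_of b" "frag_of \<omega>"] assms by (simp add: lookup_lower)

lemma raise_diff:
  assumes "a \<in> Irr H" "Poly_Mapping.keys x \<subseteq> mIrr M" "Poly_Mapping.keys y \<subseteq> mIrr M"
  shows "raise a (x - y) = raise a x - raise a y"
  unfolding tensor_diff_right by (rule hom_frag_diff [OF act_hom]) (use assms in auto)

lemma raise_cmul:
  assumes "a \<in> Irr H" "Poly_Mapping.keys x \<subseteq> mIrr M"
  shows "raise a (frag_cmul n x) = frag_cmul n (raise a x)"
  unfolding tensor_cmul_right by (rule hom_free_cmul [OF act_hom]) (use assms in auto)

lemma act_zero [simp]: "act M 0 = 0"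
  by (simp add: hom_free_zero [OF act_hom])

lemma raise_unit_irr [simp]: "Poly_Mapping.keys m \<subseteq> mIrr M \<Longrightarrow> raise (unit_irr H) m = m"
  using act_unit [of m 1] by (simp add: unit_one)

lemma lower_unit_irr:
  assumes "Poly_Mapping.keys m \<subseteq> mIrr M"
  shows "lower (unit_irr H) m = m"
  using coact_counit [of m] contract_left_counit [OF coact_keys [OF assms]] assms
  by (simp add: lower_def)

text \<open>By adjointness this is the coefficient of \<open>(c, a)\<close> in the comultiplication
  of \<open>c'\<close>. The summand with 1 on the left cannot contribute, since \<open>c\<close> is
  not 1.\<close>

lemma lookup_mult_primitive:
  assumes c: "c \<in> \<C> H" "c' \<in> \<C> H" and a: "a \<in> Irr H"
  shows "poly_mapping.lookup (hmult H (frag_of (c, a))) c' = (if c = c' \<and> a = unit_irr H then 1 else 0)"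
proof -
  have "poly_mapping.lookup (hmult H (frag_of (c, a))) c' = form (frag_of (c, a)) (hcomult H (frag_of c'))"
  proof -
    have "form (hmult H (frag_of (c, a))) (frag_of c') = form (frag_of (c, a)) (hcomult H (frag_of c'))"
      using mult_comult_adjoint c a unfolding adjoint_maps_def
      by (auto simp: primitive_in_Irr simp del: form_frag_of_left form_frag_of_right)
    then show ?thesis
      by simp
  qed
  also have "\<dots> = (if c = c' \<and> a = unit_irr H then 1 else 0)"
    using primitive_neq_unit [OF c(1)] by (simp add: comult_primitive [OF c(2)] lookup_add)
  finally show ?thesis .
qed

text \<open>A twisted Leibniz rule: \<open>\<Psi>\<^sup>k\<close> only enters through the scalar by which it acts on \<open>c\<close>.\<close>

lemma lower_raise_scalar:
  assumes c: "c \<in> \<C> H" "c' \<in> \<C> H" and m: "Poly_Mapping.keys m \<subseteq> mIrr M"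
    and \<kappa>: "Psi H k (frag_of c) = frag_cmul \<kappa> (frag_of c)"
  shows "lower c' (raise c m) = frag_cmul (if c = c' then \<kappa> else 0) m + raise c (lower c' m)"
proof -
  let ?u = "unit_irr H" and ?\<epsilon> = "\<lambda>a z. poly_mapping.lookup z a"
  note cI = primitive_in_Irr [OF c(1)]
  define Y where "Y = frag_cmul \<kappa> (frag_of (c, ?u)) + frag_of (?u, c)"
  define F where "F X = contract_left (?\<epsilon> c') (tensor_map (hmult H) (act M) (middle_swap (Y \<otimes>\<^sub>t X)))" for X
  have "Y = tensor_map (Psi H k) id (hcomult H (frag_of c))"
    by (simp add: Y_def comult_primitive [OF c(1)] tensor_map_add \<kappa> tensor_cmul_left Psi_unit_irr)
  then have 1: "lower c' (raise c m) = F (coact M m)"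
    using hopf_axiom [of "frag_of c" m] cI m by (simp add: lower_def F_def)
  \<comment> \<open>Both sides are additive in \<open>X\<close>, so
    \<open>X = frag_of (a, b)\<close> suffices. There the first summand of \<open>Y\<close> gives
    \<kappa> times the coefficient of \<open>c'\<close> in \<open>ca\<close>, times
    \<open>b\<close>, and the second gives \<open>cb\<close> if \<open>a = c'\<close>. The first
    vanishes unless \<open>c = c'\<close> and \<open>a\<close> is 1.\<close>
  have "F X = frag_cmul (if c = c' then \<kappa> else 0) (contract_left (?\<epsilon> ?u) X) + raise c (contract_left (?\<epsilon> c') X)"
    if "Poly_Mapping.keys X \<subseteq> Irr H \<times> mIrr M" for X
    using that
  proof (induction X rule: free_Abelian_group_induct [consumes 1])
    case (2 X X')
    have "raise c (contract_left (?\<epsilon> c') (X - X')) =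
        raise c (contract_left (?\<epsilon> c') X) - raise c (contract_left (?\<epsilon> c') X')"
      unfolding contract_left_diff by (rule raise_diff [OF cI keys_contract_left [OF 2(1)] keys_contract_left [OF 2(2)]])
    moreover have "F (X - X') = F X - F X'"
      by (simp add: F_def tensor_diff_right middle_swap_diff tensor_map_diff contract_left_diff)
    moreover have "frag_cmul n (a - b) = frag_cmul n a - frag_cmul n b" for n and a b :: "'m \<Rightarrow>\<^sub>0 int"
      by (rule poly_mapping_eqI) (simp add: lookup_minus algebra_simps)
    ultimately show ?case
      by (simp add: 2 contract_left_diff)
  next
    case (3 p)
    then obtain a b where p: "p = (a, b)" and ab: "a \<in> Irr H" "b \<in> mIrr M"
      by auto
    have "act M (frag_of (?u, b)) = frag_of b"
      using raise_unit_irr [of "frag_of b"] ab by simp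
    then have "F (frag_of (a, b)) =
        frag_cmul (\<kappa> * poly_mapping.lookup (hmult H (frag_of (c, a))) c') (frag_of b) +
        frag_cmul (poly_mapping.lookup (hmult H (frag_of (?u, a))) c') (raise c (frag_of b))"
      by (simp add: F_def Y_def tensor_add_left tensor_cmul_left middle_swap_add middle_swap_cmul
          tensor_map_add tensor_map_cmul contract_left_add contract_left_cmul contract_left_tensor_frag_of)
    also have "\<dots> = frag_cmul (if c = c' then \<kappa> else 0) (contract_left (?\<epsilon> ?u) (frag_of (a, b))) +
        raise c (contract_left (?\<epsilon> c') (frag_of (a, b)))"
      using c ab by (simp add: lookup_mult_primitive contract_left_def)
    finally show ?case
      by (simp only: p)
  qed (simp_all add: F_def)
  then show ?thesis
    using 1 coact_keys [OF m] lower_unit_irr [OF m] by (simp add: lower_def)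
qed

end

section \<open>The regular module and commutation of primitive elements\<close>

definition regular_module :: "'a psh \<Rightarrow> ('a, 'a) psh_mod"
  where "regular_module H = \<lparr>mIrr = Irr H, mDeg = Deg H, act = hmult H, coact = hcomult H\<rparr>"

lemma regular_module_simps [simp]:
  "mIrr (regular_module H) = Irr H" "mDeg (regular_module H) = Deg H"
  "act (regular_module H) = hmult H" "coact (regular_module H) = hcomult H"
  by (simp_all add: regular_module_def)

context psh_algebra
begin

lemma Psi_1: "Psi H (Suc 0) = id"
proof
  fix x :: "'a \<Rightarrow>\<^sub>0 int"
  show "Psi H (Suc 0) x = id x"
    using subset_UNIV
    by (induction x rule: frag_induction) (auto simp: frag_extend_diff)
qed

text \<open>Since \<Psi> with one factor is the identity, the Hopf axiom for \<open>k = 1\<close> is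
  the compatibility of multiplication and comultiplication. The module results below thereby apply
  to \<open>H\<close> itself.\<close>

lemma regular_psh_module: "psh_module H 1 (regular_module H)"
proof
  show "act (regular_module H) (hunit H a \<otimes>\<^sub>t m) = frag_cmul a m" if "m \<in> tspan (mIrr (regular_module H))" for a m
  proof -
    have m: "Poly_Mapping.keys m \<subseteq> Irr H"
      using that by simp
    then have "hmult H (frag_cmul a (frag_of (unit_irr H) \<otimes>\<^sub>t m)) = frag_cmul a (hmult H (frag_of (unit_irr H) \<otimes>\<^sub>t m))"
      by (intro hom_free_cmul [OF mult_hom]) auto
    with m show ?thesis
      by (simp add: unit_eq tensor_cmul_left)
  qed
  show "act (regular_module H) (a \<otimes>\<^sub>t act (regular_module H) (b \<otimes>\<^sub>t m)) =
      act (regular_module H) (hmult H (a \<otimes>\<^sub>t b) \<otimes>\<^sub>t m)"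
    if "a \<in> tspan (Irr H)" "b \<in> tspan (Irr H)" "m \<in> tspan (mIrr (regular_module H))" for a b m
    using assoc [of a b m] that by simp
qed (use mult_hom comult_hom mult_graded comult_graded mult_positive comult_positive mult_comult_adjoint
      coassoc counit_left comult_mult in \<open>simp_all add: Psi_1 del: Psi.simps\<close>)

text \<open>By the Leibniz rule the four inner products of \<open>cc'\<close> and \<open>c'c\<close> agree, so that
  \<open>cc' - c'c\<close> has length \<open>0\<close>.\<close>

lemma primitive_commute:
  assumes c: "c \<in> \<C> H" "c' \<in> \<C> H"
  shows "hmult H (frag_of c \<otimes>\<^sub>t frag_of c') = hmult H (frag_of c' \<otimes>\<^sub>t frag_of c)"
proof -
  interpret reg: psh_module H 1 "regular_module H"
    by (rule regular_psh_module)
  note cI [simp] = primitive_in_Irr [OF c(1)] primitive_in_Irr [OF c(2)]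
  have low: "reg.lower a (frag_of b) = (if a = b then frag_of (unit_irr H) else 0)"
    if "a \<in> \<C> H" "b \<in> \<C> H" for a b
    using primitive_neq_unit [OF that(1)] that
    by (intro poly_mapping_eqI) (auto simp: reg.lookup_lower comult_primitive lookup_add)
  have LR: "reg.lower a (hmult H (frag_of b \<otimes>\<^sub>t frag_of d)) =
      frag_cmul (if b = a then 1 else 0) (frag_of d) + hmult H (frag_of b \<otimes>\<^sub>t reg.lower a (frag_of d))"
    if "a \<in> \<C> H" "b \<in> \<C> H" "d \<in> \<C> H" for a b d
    using reg.lower_raise_scalar [of b a "frag_of d" 1] that by (simp add: Psi_1 primitive_in_Irr)
  \<comment> \<open>Moving \<open>a\<close> across the form leaves \<open>b\<close> paired with the
    lowering of a product of two primitives, which the Leibniz rule computes.\<close>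
  have F: "form (hmult H (frag_of a \<otimes>\<^sub>t frag_of b)) (hmult H (frag_of c \<otimes>\<^sub>t frag_of d)) =
      (if a = c \<and> b = d then 1 else 0) + (if a = d \<and> b = c then 1 else 0)"
    if "a \<in> \<C> H" "b \<in> \<C> H" "c \<in> \<C> H" "d \<in> \<C> H" for a b c d
  proof -
    have "form (hmult H (frag_of a \<otimes>\<^sub>t frag_of b)) (hmult H (frag_of c \<otimes>\<^sub>t frag_of d)) =
        form (frag_of b) (reg.lower a (hmult H (frag_of c \<otimes>\<^sub>t frag_of d)))"
      using reg.form_raise [of a "frag_of b" "hmult H (frag_of c \<otimes>\<^sub>t frag_of d)"] that
        mult_keys [of "frag_of (c, d)"]
      by (simp add: primitive_in_Irr)
    also have "\<dots> = form (frag_of b) (frag_cmul (if c = a then 1 else 0) (frag_of d) +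
        (if a = d then frag_of c else 0))"
    proof -
      have "hmult H (frag_of c \<otimes>\<^sub>t reg.lower a (frag_of d)) = (if a = d then frag_of c else 0)"
        using that primitive_in_Irr [OF that(3)] by (simp add: low hom_free_zero [OF mult_hom])
      then show ?thesis
        by (simp only: LR [OF that(1,3,4)])
    qed
    also have "\<dots> = (if a = c \<and> b = d then 1 else 0) + (if a = d \<and> b = c then 1 else 0)"
      by (cases "a = c"; cases "a = d"; cases "b = c"; cases "b = d") (simp_all add: lookup_add)
    finally show ?thesis .
  qed
  define p where "p = hmult H (frag_of c \<otimes>\<^sub>t frag_of c') - hmult H (frag_of c' \<otimes>\<^sub>t frag_of c)"
  have "form p p = 0"
    unfolding p_def form_diff_left form_diff_right F [OF c c] F [OF c(2,1) c] F [OF c c(2,1)]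
      F [OF c(2,1) c(2,1)]
    by auto
  then have "p = 0"
    by (rule form_self_eq_0D)
  then show ?thesis
    by (simp add: p_def)
qed

end

section \<open>Products of primitive elements\<close>

text \<open>\<open>H\<close> is only shown to be commutative on primitive elements, so that \<open>finprod\<close> is needed in a
  monoid which is not known to be commutative.\<close>

lemma (in monoid) finprod_insert_commuting:
  assumes "finite A" "a \<notin> A" and closed: "f \<in> insert a A \<rightarrow> carrier G"
    and comm: "\<And>x y. \<lbrakk>x \<in> insert a A; y \<in> insert a A\<rbrakk> \<Longrightarrow> f x \<otimes> f y = f y \<otimes> f x"
  shows "finprod G f (insert a A) = f a \<otimes> finprod G f A" "finprod G f A \<in> carrier G"
proof -
  \<comment> \<open>The fold behind \<open>finprod\<close> needs left multiplications by the factors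
    to commute; associativity reduces this to commutation of the factors.\<close>
  interpret LCD "insert a A" "carrier G" "(\<otimes>) \<circ> f"
  proof
    show "((\<otimes>) \<circ> f) x (((\<otimes>) \<circ> f) y z) = ((\<otimes>) \<circ> f) y (((\<otimes>) \<circ> f) x z)"
      if "x \<in> insert a A" "y \<in> insert a A" "z \<in> carrier G" for x y z
    proof -
      have "f x \<in> carrier G" "f y \<in> carrier G"
        using that closed by auto
      then show ?thesis
        using that(3) comm [OF that(1,2)] by (simp add: m_assoc [symmetric])
    qed
  qed (use closed in auto)
  show "finprod G f (insert a A) = f a \<otimes> finprod G f A"
    using foldD_insert [of A a \<one>] assms(1,2) by (auto simp: finprod_def)
  show "finprod G f A \<in> carrier G"
    using foldD_closed [OF assms(1) one_closed subset_insertI] assms(1) by (simp add: finprod_def)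
qed

lemma (in monoid) finprod_cong_commuting:
  assumes "finite A" "\<And>x. x \<in> A \<Longrightarrow> f x = g x" and "f \<in> A \<rightarrow> carrier G"
    and "\<And>x y. \<lbrakk>x \<in> A; y \<in> A\<rbrakk> \<Longrightarrow> f x \<otimes> f y = f y \<otimes> f x"
  shows "finprod G f A = finprod G g A"
  using assms
proof (induction A rule: finite_induct)
  case empty
  show ?case
    by (simp add: finprod_def)
next
  case (insert a A)
  have f: "f x = g x" if "x \<in> insert a A" for x
    using insert.prems(1) [OF that] .
  have "finprod G f (insert a A) = f a \<otimes> finprod G f A"
    using insert by (intro finprod_insert_commuting) auto
  moreover have "g x \<otimes> g y = g y \<otimes> g x" if "x \<in> insert a A" "y \<in> insert a A" for x y
    using insert.prems(3) [OF that] f [OF that(1)] f [OF that(2)] by simp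
  then have "finprod G g (insert a A) = g a \<otimes> finprod G g A"
    using insert f by (intro finprod_insert_commuting) (auto simp: Pi_iff)
  moreover have "finprod G f A = finprod G g A"
    using insert.prems by (intro insert.IH) auto
  ultimately show ?case
    using f by simp
qed

section \<open>Induction over finitely supported exponents\<close>

lemma finsupp_zero [simp]: "0 \<in> finsupp C"
  by (simp add: finsupp_def)

lemma finsupp_single [simp]: "c \<in> C \<Longrightarrow> Poly_Mapping.single c n \<in> finsupp C"
  by (simp add: finsupp_def)

lemma finsupp_add [simp]: "\<lbrakk>\<phi> \<in> finsupp C; \<psi> \<in> finsupp C\<rbrakk> \<Longrightarrow> \<phi> + \<psi> \<in> finsupp C"
  using keys_add [of \<phi> \<psi>] by (auto simp: finsupp_def)

lemma finsupp_split:
  assumes "\<phi> \<in> finsupp C" "c \<in> Poly_Mapping.keys \<phi>"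
  obtains \<psi> where "\<psi> \<in> finsupp C" "c \<in> C" "\<phi> = \<psi> + Poly_Mapping.single c 1"
proof
  \<comment> \<open>Subtraction of naturals truncates; positivity at \<open>c\<close> makes adding 1
    back exact.\<close>
  have *: "poly_mapping.lookup \<phi> c > 0"
    using assms(2) by (simp add: in_keys_iff)
  show "\<phi> = (\<phi> - Poly_Mapping.single c 1) + Poly_Mapping.single c 1"
    by (rule poly_mapping_eqI) (use * in \<open>auto simp: lookup_add lookup_minus lookup_single when_def\<close>)
  show "\<phi> - Poly_Mapping.single c 1 \<in> finsupp C"
    using assms(1) by (auto simp: finsupp_def in_keys_iff subset_iff lookup_minus)
  show "c \<in> C"
    using assms by (auto simp: finsupp_def)
qed

text \<open>Induction on the total multiplicity, with a step that matches multiplication by one more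
  primitive.\<close>

lemma finsupp_induct [consumes 1, case_names zero add]:
  assumes "\<phi> \<in> finsupp C" and "P 0"
    and step: "\<And>\<phi> c. \<lbrakk>\<phi> \<in> finsupp C; c \<in> C; P \<phi>\<rbrakk> \<Longrightarrow> P (\<phi> + Poly_Mapping.single c 1)"
  shows "P \<phi>"
  using assms(1)
proof (induction "\<Sum>c\<in>Poly_Mapping.keys \<phi>. poly_mapping.lookup \<phi> c" arbitrary: \<phi> rule: less_induct)
  case less
  show ?case
  proof (cases "\<phi> = 0")
    case False
    then obtain c where c: "c \<in> Poly_Mapping.keys \<phi>"
      by (meson keys_eq_empty ex_in_conv)
    then obtain \<psi> where \<psi>: "\<psi> \<in> finsupp C" "c \<in> C" "\<phi> = \<psi> + Poly_Mapping.single c 1"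
      using finsupp_split [OF less.prems] by blast
    have sub: "Poly_Mapping.keys \<psi> \<subseteq> Poly_Mapping.keys \<phi>"
      by (auto simp: \<psi>(3) in_keys_iff lookup_add)
    \<comment> \<open>The support may shrink when a multiplicity drops to 0, so both totals are
      taken over the larger support.\<close>
    have "(\<Sum>c\<in>Poly_Mapping.keys \<psi>. poly_mapping.lookup \<psi> c) = (\<Sum>c\<in>Poly_Mapping.keys \<phi>. poly_mapping.lookup \<psi> c)"
      using sub by (intro sum.mono_neutral_left) (auto simp: in_keys_iff)
    also have "\<dots> < (\<Sum>c\<in>Poly_Mapping.keys \<phi>. poly_mapping.lookup \<phi> c)"
      by (rule sum_strict_mono_ex1) (use c in \<open>auto simp: \<psi>(3) lookup_add lookup_single intro!: bexI [of _ c]\<close>)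
    finally have "P \<psi>"
      using less.hyps \<psi>(1) by blast
    then show ?thesis
      using step \<psi> by blast
  qed (simp add: \<open>P 0\<close>)
qed

context psh_algebra
begin

section \<open>The products \<open>pi_prod\<close>\<close>

lemma monoid_mult_monoid: "monoid (mult_monoid H)"
proof
  show "x \<otimes>\<^bsub>mult_monoid H\<^esub> y \<in> carrier (mult_monoid H)"
    if "x \<in> carrier (mult_monoid H)" "y \<in> carrier (mult_monoid H)" for x y
    using that mult_keys [of "x \<otimes>\<^sub>t y"] by (auto simp: mult_monoid_def)
qed (auto simp: mult_monoid_def assoc unit_one)

lemma pi_prod_zero [simp]: "pi_prod H 0 = frag_of (unit_irr H)"
  by (simp add: pi_prod_def finprod_def mult_monoid_def unit_one)

text \<open>The recursion by which the later inductions avoid \<open>finprod\<close>. The power of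
  \<open>c\<close> is split off; the product over the remaining support does not change.\<close>

lemma pi_prod_add_single:
  assumes \<phi>: "\<phi> \<in> finsupp (\<C> H)" and c: "c \<in> \<C> H"
  shows "pi_prod H (\<phi> + Poly_Mapping.single c 1) = hmult H (frag_of c \<otimes>\<^sub>t pi_prod H \<phi>)"
proof -
  interpret monoid "mult_monoid H"
    by (rule monoid_mult_monoid)
  let ?G = "mult_monoid H"
  define f where "f \<phi> = (\<lambda>c. frag_of c [^]\<^bsub>?G\<^esub> (poly_mapping.lookup \<phi> c :: nat))" for \<phi>
  have carr: "frag_of a \<in> carrier ?G" if "a \<in> \<C> H" for a
    using that by (simp add: mult_monoid_def primitive_in_Irr)
  then have f_carr: "f \<phi> a \<in> carrier ?G" if "a \<in> \<C> H" for a \<phi>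
    using that by (simp add: f_def)
  have f_comm: "f \<phi> a \<otimes>\<^bsub>?G\<^esub> f \<phi> b = f \<phi> b \<otimes>\<^bsub>?G\<^esub> f \<phi> a" if ab: "a \<in> \<C> H" "b \<in> \<C> H" for a b \<phi>
  proof -
    have "frag_of a \<otimes>\<^bsub>?G\<^esub> frag_of b = frag_of b \<otimes>\<^bsub>?G\<^esub> frag_of a"
      using primitive_commute [OF ab] by (simp add: mult_monoid_def)
    then have "f \<phi> a \<otimes>\<^bsub>?G\<^esub> frag_of b = frag_of b \<otimes>\<^bsub>?G\<^esub> f \<phi> a"
      using group_commutes_pow carr ab by (simp add: f_def)
    then show ?thesis
      using group_commutes_pow [of "frag_of b" "f \<phi> a"] carr f_carr ab by (simp add: f_def)
  qed
  \<comment> \<open>Removing \<open>c\<close> in every case treats old and new primitives alike: if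
    \<open>c\<close> was absent from \<phi>, its power is the unit.\<close>
  let ?K = "Poly_Mapping.keys \<phi> - {c}"
  have K: "insert c ?K \<subseteq> \<C> H" "finite ?K" "c \<notin> ?K"
    using \<phi> c by (auto simp: finsupp_def)
  have ins: "finprod ?G (f \<psi>) (insert c ?K) = f \<psi> c \<otimes>\<^bsub>?G\<^esub> finprod ?G (f \<psi>) ?K"
    and fin_carr: "finprod ?G (f \<psi>) ?K \<in> carrier ?G" for \<psi>
    using K f_carr f_comm by (intro finprod_insert_commuting; blast)+
  have "pi_prod H \<phi> = f \<phi> c \<otimes>\<^bsub>?G\<^esub> finprod ?G (f \<phi>) ?K"
  proof (cases "c \<in> Poly_Mapping.keys \<phi>")
    case True
    then show ?thesis
      using ins [of \<phi>] by (simp add: pi_prod_def f_def insert_absorb)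
  next
    case False
    then have "f \<phi> c = \<one>\<^bsub>?G\<^esub>"
      by (simp add: f_def in_keys_iff)
    with False show ?thesis
      using fin_carr [of \<phi>] by (simp add: pi_prod_def f_def)
  qed
  moreover have "Poly_Mapping.keys (\<phi> + Poly_Mapping.single c 1) = insert c ?K"
    by (auto simp: in_keys_iff lookup_add lookup_single when_def split: if_splits)
  then have "pi_prod H (\<phi> + Poly_Mapping.single c 1) =
      f (\<phi> + Poly_Mapping.single c 1) c \<otimes>\<^bsub>?G\<^esub> finprod ?G (f (\<phi> + Poly_Mapping.single c 1)) ?K"
    using ins [of "\<phi> + Poly_Mapping.single c 1"] by (simp add: pi_prod_def f_def)
  moreover have "finprod ?G (f (\<phi> + Poly_Mapping.single c 1)) ?K = finprod ?G (f \<phi>) ?K"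
  proof (rule finprod_cong_commuting)
    show "f (\<phi> + Poly_Mapping.single c 1) x = f \<phi> x" if "x \<in> ?K" for x
      using that by (auto simp: f_def lookup_add lookup_single when_def)
  qed (use K f_carr f_comm in blast)+
  moreover have "f (\<phi> + Poly_Mapping.single c 1) c = frag_of c \<otimes>\<^bsub>?G\<^esub> f \<phi> c"
    using nat_pow_Suc2 [OF carr [OF c]] by (simp add: f_def lookup_add)
  ultimately have "pi_prod H (\<phi> + Poly_Mapping.single c 1) = frag_of c \<otimes>\<^bsub>?G\<^esub> pi_prod H \<phi>"
    using m_assoc [OF carr [OF c] f_carr [OF c, of \<phi>] fin_carr [of \<phi>]] by simp
  then show ?thesis
    by (simp add: mult_monoid_def)
qed

lemma pi_prod_keys:
  assumes "\<phi> \<in> finsupp (\<C> H)"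
  shows "Poly_Mapping.keys (pi_prod H \<phi>) \<subseteq> Irr H"
  using assms
proof (induction \<phi> rule: finsupp_induct)
  case (add \<phi> c)
  have "Poly_Mapping.keys (hmult H (frag_of c \<otimes>\<^sub>t pi_prod H \<phi>)) \<subseteq> Irr H"
    by (rule mult_keys) (use add primitive_in_Irr in auto)
  with add show ?case
    by (simp only: pi_prod_add_single)
qed simp

lemma pi_prod_add:
  assumes "\<phi> \<in> finsupp (\<C> H)" "\<psi> \<in> finsupp (\<C> H)"
  shows "pi_prod H (\<phi> + \<psi>) = hmult H (pi_prod H \<phi> \<otimes>\<^sub>t pi_prod H \<psi>)"
  using assms(1)
proof (induction \<phi> rule: finsupp_induct)
  case zero
  then show ?case
    using pi_prod_keys [OF assms(2)] by simp
next
  case (add \<phi> c)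
  have "pi_prod H (\<phi> + Poly_Mapping.single c 1 + \<psi>) = pi_prod H (\<phi> + \<psi> + Poly_Mapping.single c 1)"
    by (metis add.assoc add.commute)
  also have "\<dots> = hmult H (frag_of c \<otimes>\<^sub>t hmult H (pi_prod H \<phi> \<otimes>\<^sub>t pi_prod H \<psi>))"
    using add assms(2) by (simp only: pi_prod_add_single finsupp_add)
  also have "\<dots> = hmult H (hmult H (frag_of c \<otimes>\<^sub>t pi_prod H \<phi>) \<otimes>\<^sub>t pi_prod H \<psi>)"
    using assoc [of "frag_of c" "pi_prod H \<phi>" "pi_prod H \<psi>"] add assms(2) pi_prod_keys primitive_in_Irr
    by simp
  finally show ?case
    using add by (simp only: pi_prod_add_single)
qed

lemma pi_prod_positive:
  assumes "\<phi> \<in> finsupp (\<C> H)"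
  shows "positive (Irr H) (pi_prod H \<phi>)"
  using assms
proof (induction \<phi> rule: finsupp_induct)
  case zero
  show ?case
    by (simp add: positive_frag_of)
next
  case (add \<phi> c)
  then have "positive (Irr H) (hmult H (frag_of c \<otimes>\<^sub>t pi_prod H \<phi>))"
    using mult_positive by (auto simp: positive_map_def intro!: positive_tensor positive_frag_of primitive_in_Irr)
  with add show ?case
    by (simp only: pi_prod_add_single)
qed

lemma \<Omega>_alg_eq_keys: "\<phi> \<in> finsupp (\<C> H) \<Longrightarrow> \<Omega>_alg H \<phi> = Poly_Mapping.keys (pi_prod H \<phi>)"
  unfolding \<Omega>_alg_def by (rule constituents_positive [OF pi_prod_positive])

end

context psh_module
begin

section \<open>Products of primitives applied to a module primitive, and their orthogonality\<close>

lemma mod_primitive_in_mIrr: "d \<in> \<D> H M \<Longrightarrow> d \<in> mIrr M"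
  by (simp add: \<D>_def)

lemma lower_mod_primitive:
  assumes d: "d \<in> \<D> H M" and c: "c \<in> \<C> H"
  shows "lower c (frag_of d) = 0"
proof -
  have "coact M (frag_of d) = frag_of (unit_irr H, d)"
    using d by (simp add: \<D>_def mod_primitive_def unit_one)
  then show ?thesis
    using primitive_neq_unit [OF c] by (intro poly_mapping_eqI) (auto simp: lookup_lower)
qed

lemma pi_mod_zero [simp]: "d \<in> mIrr M \<Longrightarrow> pi_mod H M d 0 = frag_of d"
  using raise_unit_irr [of "frag_of d"] by (simp add: pi_mod_def)

lemma act_pi_prod_pi_mod:
  assumes "d \<in> mIrr M" "\<phi> \<in> finsupp (\<C> H)" "\<psi> \<in> finsupp (\<C> H)"
  shows "act M (pi_prod H \<phi> \<otimes>\<^sub>t pi_mod H M d \<psi>) = pi_mod H M d (\<phi> + \<psi>)"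
  using assms act_assoc [of "pi_prod H \<phi>" "pi_prod H \<psi>" "frag_of d"] pi_prod_keys
  by (simp add: pi_mod_def pi_prod_add)

lemma pi_mod_add_single:
  assumes "d \<in> mIrr M" "\<phi> \<in> finsupp (\<C> H)" "c \<in> \<C> H"
  shows "pi_mod H M d (\<phi> + Poly_Mapping.single c 1) = raise c (pi_mod H M d \<phi>)"
  using assms act_assoc [of "frag_of c" "pi_prod H \<phi>" "frag_of d"] pi_prod_keys [OF assms(2)]
    primitive_in_Irr [OF assms(3)] pi_prod_add_single [OF assms(2,3)]
  by (simp add: pi_mod_def)

lemma pi_mod_positive:
  assumes "d \<in> mIrr M" "\<phi> \<in> finsupp (\<C> H)"
  shows "positive (mIrr M) (pi_mod H M d \<phi>)"
  using act_positive assms pi_prod_positive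
  by (auto simp: positive_map_def pi_mod_def intro!: positive_tensor positive_frag_of)

lemma pi_mod_keys:
  "\<lbrakk>d \<in> mIrr M; \<phi> \<in> finsupp (\<C> H)\<rbrakk> \<Longrightarrow> Poly_Mapping.keys (pi_mod H M d \<phi>) \<subseteq> mIrr M"
  using pi_mod_positive by (simp add: positive_iff)

lemma \<Omega>_mod_eq_keys:
  "\<lbrakk>d \<in> mIrr M; \<phi> \<in> finsupp (\<C> H)\<rbrakk> \<Longrightarrow> \<Omega>_mod H M d \<phi> = Poly_Mapping.keys (pi_mod H M d \<phi>)"
  unfolding \<Omega>_mod_def by (rule constituents_positive [OF pi_mod_positive])

text \<open>The scalar depends on \<open>c\<close> alone, so a single one serves all
  \<open>c'\<close> and \<open>m\<close>.\<close>

lemma lower_raise: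
  assumes "c \<in> \<C> H"
  obtains n where "\<And>c' m. \<lbrakk>c' \<in> \<C> H; Poly_Mapping.keys m \<subseteq> mIrr M\<rbrakk>
    \<Longrightarrow> lower c' (raise c m) = frag_cmul (if c = c' then n else 0) m + raise c (lower c' m)"
proof -
  obtain n where "Psi H k (frag_of c) = frag_cmul n (frag_of c)"
    using Psi_primitive [OF assms] .
  then show thesis
    using that lower_raise_scalar [OF assms] by blast
qed

text \<open>With no factor \<open>c\<close> present, the Leibniz rule moves the lowering operator
  past every factor until it reaches \<open>d\<close>, which it kills.\<close>

lemma lower_pi_mod_eq_0:
  assumes d: "d \<in> \<D> H M" and c: "c \<in> \<C> H" and "\<phi> \<in> finsupp (\<C> H)" "c \<notin> Poly_Mapping.keys \<phi>"
  shows "lower c (pi_mod H M d \<phi>) = 0"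
  using assms(3,4)
proof (induction \<phi> rule: finsupp_induct)
  case zero
  show ?case
    using d c by (simp add: mod_primitive_in_mIrr lower_mod_primitive)
next
  case (add \<phi> c')
  have "c' \<noteq> c" "c \<notin> Poly_Mapping.keys \<phi>"
    using add.prems by (auto simp: in_keys_iff lookup_add)
  moreover obtain n where "\<And>c'' m. \<lbrakk>c'' \<in> \<C> H; Poly_Mapping.keys m \<subseteq> mIrr M\<rbrakk>
    \<Longrightarrow> lower c'' (raise c' m) = frag_cmul (if c' = c'' then n else 0) m + raise c' (lower c'' m)"
    using lower_raise [OF add(2)] by blast
  ultimately show ?case
    using pi_mod_add_single [OF mod_primitive_in_mIrr [OF d] add(1,2)] c
      pi_mod_keys [OF mod_primitive_in_mIrr [OF d] add(1)] add.IH by simp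
qed

text \<open>Induction on the multiplicity of \<open>c\<close> in \<phi>. Passing one factor
  \<open>c\<close> yields a multiple of the remaining product; the lowering of that product is known
  from the induction, or is 0 when no \<open>c\<close> is left.\<close>

lemma lower_pi_mod_add_single:
  assumes d: "d \<in> \<D> H M" and c: "c \<in> \<C> H" and \<phi>: "\<phi> \<in> finsupp (\<C> H)"
  shows "\<exists>n. lower c (pi_mod H M d (\<phi> + Poly_Mapping.single c 1)) = frag_cmul n (pi_mod H M d \<phi>)"
  using \<phi>
proof (induction "poly_mapping.lookup \<phi> c" arbitrary: \<phi>)
  case 0
  obtain n where "\<And>c'' m. \<lbrakk>c'' \<in> \<C> H; Poly_Mapping.keys m \<subseteq> mIrr M\<rbrakk>
    \<Longrightarrow> lower c'' (raise c m) = frag_cmul (if c = c'' then n else 0) m + raise c (lower c'' m)"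
    using lower_raise [OF c] by blast
  moreover have "lower c (pi_mod H M d \<phi>) = 0"
    using 0 by (intro lower_pi_mod_eq_0 [OF d c]) (simp_all add: in_keys_iff)
  ultimately show ?case
    using pi_mod_add_single [OF mod_primitive_in_mIrr [OF d] 0(2) c] c
      pi_mod_keys [OF mod_primitive_in_mIrr [OF d] 0(2)] by (intro exI [of _ n]) simp
next
  case (Suc l)
  then have "c \<in> Poly_Mapping.keys \<phi>"
    by (simp add: in_keys_iff)
  then obtain \<psi> where \<psi>: "\<psi> \<in> finsupp (\<C> H)" "\<phi> = \<psi> + Poly_Mapping.single c 1"
    using finsupp_split Suc.prems by metis
  then have "l = poly_mapping.lookup \<psi> c"
    using Suc.hyps(2) by (simp add: lookup_add)
  then obtain n where n: "lower c (pi_mod H M d \<phi>) = frag_cmul n (pi_mod H M d \<psi>)"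
    using Suc.hyps(1) \<psi> by blast
  note dI = mod_primitive_in_mIrr [OF d]
  obtain n' where "\<And>c'' m. \<lbrakk>c'' \<in> \<C> H; Poly_Mapping.keys m \<subseteq> mIrr M\<rbrakk>
    \<Longrightarrow> lower c'' (raise c m) = frag_cmul (if c = c'' then n' else 0) m + raise c (lower c'' m)"
    using lower_raise [OF c] by blast
  then have "lower c (pi_mod H M d (\<phi> + Poly_Mapping.single c 1)) =
      frag_cmul n' (pi_mod H M d \<phi>) + raise c (frag_cmul n (pi_mod H M d \<psi>))"
    using pi_mod_add_single [OF dI Suc.prems c] c pi_mod_keys [OF dI Suc.prems] n by simp
  \<comment> \<open>Raising the product for \<psi> by \<open>c\<close> restores the one for \<phi>,
    so both terms are multiples of the same element.\<close>
  also have "\<dots> = frag_cmul (n' + n) (pi_mod H M d \<phi>)"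
    using raise_cmul [OF primitive_in_Irr [OF c] pi_mod_keys [OF dI \<psi>(1)]]
      pi_mod_add_single [OF dI \<psi>(1) c] by (simp add: \<psi>(2) frag_cmul_distrib)
  finally show ?case ..
qed

text \<open>Moving one factor \<open>c\<close> across the form lowers the other side, which either
  vanishes or loses a \<open>c\<close> as well.\<close>

lemma form_pi_mod_eq_0:
  assumes d: "d \<in> \<D> H M" "d' \<in> \<D> H M" and \<phi>: "\<phi> \<in> finsupp (\<C> H)" "\<phi>' \<in> finsupp (\<C> H)"
    and neq: "(d, \<phi>) \<noteq> (d', \<phi>')"
  shows "form (pi_mod H M d \<phi>) (pi_mod H M d' \<phi>') = 0"
  using \<phi> neq
proof (induction \<phi> arbitrary: \<phi>' rule: finsupp_induct)
  case zero
  note dI = mod_primitive_in_mIrr [OF d(1)] mod_primitive_in_mIrr [OF d(2)]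
  show ?case
  proof (cases "\<phi>' = 0")
    case True
    then show ?thesis
      using zero dI by simp
  next
    case False
    then obtain c where "c \<in> Poly_Mapping.keys \<phi>'"
      by (meson keys_eq_empty ex_in_conv)
    then obtain \<psi> where \<psi>: "\<psi> \<in> finsupp (\<C> H)" "c \<in> \<C> H" "\<phi>' = \<psi> + Poly_Mapping.single c 1"
      using finsupp_split zero(1) by metis
    \<comment> \<open>By symmetry of the form a factor is now moved off the right-hand product, onto
      \<open>d\<close>, where it acts as 0.\<close>
    have "form (pi_mod H M d' \<phi>') (frag_of d) = form (pi_mod H M d' \<psi>) (lower c (frag_of d))"
      unfolding \<psi>(3) pi_mod_add_single [OF dI(2) \<psi>(1,2)]
      by (rule form_raise) (use dI \<psi> primitive_in_Irr pi_mod_keys in auto)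
    then show ?thesis
      using lower_mod_primitive [OF d(1) \<psi>(2)] dI by simp
  qed
next
  case (add \<phi> c)
  note dI = mod_primitive_in_mIrr [OF d(1)] mod_primitive_in_mIrr [OF d(2)]
  have eq: "form (pi_mod H M d (\<phi> + Poly_Mapping.single c 1)) (pi_mod H M d' \<phi>') =
      form (pi_mod H M d \<phi>) (lower c (pi_mod H M d' \<phi>'))"
    unfolding pi_mod_add_single [OF dI(1) add(1,2)]
    by (rule form_raise) (use dI add primitive_in_Irr pi_mod_keys in auto)
  show ?case
  proof (cases "c \<in> Poly_Mapping.keys \<phi>'")
    case False
    then show ?thesis
      using eq lower_pi_mod_eq_0 [OF d(2) add(2) add.prems(1)] by simp
  next
    case True
    then obtain \<psi> where \<psi>: "\<psi> \<in> finsupp (\<C> H)" "\<phi>' = \<psi> + Poly_Mapping.single c 1"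
      using finsupp_split add.prems(1) by metis
    \<comment> \<open>The shortened pairs still differ, since adding \<open>c\<close> to both would
      otherwise identify the original ones.\<close>
    then have "form (pi_mod H M d \<phi>) (pi_mod H M d' \<psi>) = 0"
      using add.prems by (intro add.IH) auto
    moreover obtain n where "lower c (pi_mod H M d' \<phi>') = frag_cmul n (pi_mod H M d' \<psi>)"
      using lower_pi_mod_add_single [OF d(2) add(2) \<psi>(1)] \<psi>(2) by blast
    ultimately show ?thesis
      using eq by (simp add: form_cmul_right)
  qed
qed

lemma \<Omega>_mod_disjoint:
  assumes "d \<in> \<D> H M" "d' \<in> \<D> H M" "\<phi> \<in> finsupp (\<C> H)" "\<phi>' \<in> finsupp (\<C> H)" "(d, \<phi>) \<noteq> (d', \<phi>')"
  shows "\<Omega>_mod H M d \<phi> \<inter> \<Omega>_mod H M d' \<phi>' = {}"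
  using keys_disjoint_if_form_eq_0 [OF pi_mod_positive pi_mod_positive form_pi_mod_eq_0] assms
  by (simp add: \<Omega>_mod_eq_keys mod_primitive_in_mIrr)

end

section \<open>Every irreducible element is a constituent of such a product\<close>

context psh_module
begin

lemma coact_degree:
  assumes "\<omega> \<in> mIrr M" "(a, b) \<in> Poly_Mapping.keys (coact M (frag_of \<omega>))"
  shows "Deg H a + mDeg M b = mDeg M \<omega>"
proof -
  have "frag_of \<omega> \<in> homogeneous (mIrr M) (mDeg M) (mDeg M \<omega>)"
    using assms(1) by (simp add: homogeneous_def)
  then have "coact M (frag_of \<omega>) \<in> homogeneous (Irr H \<times> mIrr M) (tensor_deg (Deg H) (mDeg M)) (mDeg M \<omega>)"
    using coact_graded unfolding graded_map_def by blast
  then show ?thesis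
    using assms(2) by (auto simp: homogeneous_def tensor_deg_def)
qed

text \<open>The counit axiom fixes the coefficients with left factor 1. If there were no others, the
  coaction would be that of a module primitive.\<close>

lemma coact_not_mod_primitive:
  assumes \<omega>: "\<omega> \<in> mIrr M" "\<omega> \<notin> \<D> H M"
  shows "\<exists>a b. (a, b) \<in> Poly_Mapping.keys (coact M (frag_of \<omega>)) \<and> a \<noteq> unit_irr H"
proof (rule ccontr)
  assume contr: "\<nexists>a b. (a, b) \<in> Poly_Mapping.keys (coact M (frag_of \<omega>)) \<and> a \<noteq> unit_irr H"
  then have fst: "a = unit_irr H" if "(a, b) \<in> Poly_Mapping.keys (coact M (frag_of \<omega>))" for a b
    using that contr by blast
  have "coact M (frag_of \<omega>) = frag_of (unit_irr H, \<omega>)"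
  proof (rule poly_mapping_eqI)
    fix p :: "'a \<times> 'm"
    obtain a b where p: "p = (a, b)"
      by (cases p)
    have "poly_mapping.lookup (coact M (frag_of \<omega>)) (unit_irr H, b) = poly_mapping.lookup (frag_of \<omega>) b"
      using lower_unit_irr [of "frag_of \<omega>"] \<omega>(1) lookup_lower [of "unit_irr H" "frag_of \<omega>" b] by simp
    moreover have "poly_mapping.lookup (coact M (frag_of \<omega>)) (a, b) = 0" if "a \<noteq> unit_irr H"
      using fst that by (auto simp: in_keys_iff)
    ultimately show "poly_mapping.lookup (coact M (frag_of \<omega>)) p = poly_mapping.lookup (frag_of (unit_irr H, \<omega>)) p"
      by (cases "a = unit_irr H") (auto simp: p)
  qed
  with \<omega> show False
    by (simp add: \<D>_def mod_primitive_def unit_one)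
qed

lemma act_tensor_in_keys:
  assumes "positive (Irr H) h" "positive (mIrr M) m" "a \<in> Poly_Mapping.keys h" "b \<in> Poly_Mapping.keys m"
    and "\<omega> \<in> Poly_Mapping.keys (act M (frag_of (a, b)))"
  shows "\<omega> \<in> Poly_Mapping.keys (act M (h \<otimes>\<^sub>t m))"
  by (rule positive_map_in_keys [OF act_hom act_positive positive_tensor]) (use assms in auto)

text \<open>By positivity the constituents of \<open>ab\<close> survive in the product of
  \<open>pi_prod H \<phi>\<close> with \<open>pi_mod H M d \<psi>\<close>, which is
  \<open>pi_mod H M d (\<phi> + \<psi>)\<close>.\<close>

lemma act_\<Omega>_keys:
  assumes d: "d \<in> mIrr M" and \<phi>: "\<phi> \<in> finsupp (\<C> H)" "\<psi> \<in> finsupp (\<C> H)"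
    and a: "a \<in> \<Omega>_alg H \<phi>" and b: "b \<in> \<Omega>_mod H M d \<psi>"
  shows "Poly_Mapping.keys (act M (frag_of (a, b))) \<subseteq> \<Omega>_mod H M d (\<phi> + \<psi>)"
  using act_tensor_in_keys [OF pi_prod_positive [OF \<phi>(1)] pi_mod_positive [OF d \<phi>(2)]] assms
  by (auto simp: \<Omega>_alg_eq_keys \<Omega>_mod_eq_keys act_pi_prod_pi_mod)

lemma coact_keys_iff_act_keys:
  assumes "\<omega> \<in> mIrr M" "a \<in> Irr H" "b \<in> mIrr M"
  shows "(a, b) \<in> Poly_Mapping.keys (coact M (frag_of \<omega>)) \<longleftrightarrow> \<omega> \<in> Poly_Mapping.keys (act M (frag_of (a, b)))"
  using lookup_act_frag_of [of a b \<omega>] assms by (simp add: in_keys_iff)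

lemma mod_primitive_in_\<Omega>_mod: "d \<in> \<D> H M \<Longrightarrow> d \<in> \<Omega>_mod H M d 0"
  by (simp add: \<Omega>_mod_eq_keys mod_primitive_in_mIrr)

end

context psh_algebra
begin

section \<open>The case of the algebra, through its regular module\<close>

lemma unit_irr_in_\<D>_regular: "unit_irr H \<in> \<D> H (regular_module H)"
  by (simp add: \<D>_def mod_primitive_def comult_unit_irr unit_one)

lemma \<Omega>_mod_regular: "\<phi> \<in> finsupp (\<C> H) \<Longrightarrow> \<Omega>_mod H (regular_module H) (unit_irr H) \<phi> = \<Omega>_alg H \<phi>"
  by (simp add: \<Omega>_mod_def \<Omega>_alg_def pi_mod_def pi_prod_keys)

lemma \<Omega>_alg_disjoint:
  assumes "\<phi> \<in> finsupp (\<C> H)" "\<psi> \<in> finsupp (\<C> H)" "\<phi> \<noteq> \<psi>"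
  shows "\<Omega>_alg H \<phi> \<inter> \<Omega>_alg H \<psi> = {}"
proof -
  interpret reg: psh_module H 1 "regular_module H"
    by (rule regular_psh_module)
  show ?thesis
    using reg.\<Omega>_mod_disjoint [OF unit_irr_in_\<D>_regular unit_irr_in_\<D>_regular assms(1,2)] assms
    by (simp add: \<Omega>_mod_regular)
qed

text \<open>The two counit axioms fix all coefficients with a factor 1, and these agree with those
  of a primitive element. Some other coefficient must therefore be nonzero.\<close>

lemma comult_not_primitive:
  assumes \<omega>: "\<omega> \<in> Irr H" "\<omega> \<noteq> unit_irr H" "\<omega> \<notin> \<C> H"
  shows "\<exists>a b. (a, b) \<in> Poly_Mapping.keys (hcomult H (frag_of \<omega>)) \<and> a \<noteq> unit_irr H \<and> b \<noteq> unit_irr H"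
proof (rule ccontr)
  let ?u = "unit_irr H"
  assume contr: "\<nexists>a b. (a, b) \<in> Poly_Mapping.keys (hcomult H (frag_of \<omega>)) \<and> a \<noteq> ?u \<and> b \<noteq> ?u"
  then have *: "a = ?u \<or> b = ?u" if "(a, b) \<in> Poly_Mapping.keys (hcomult H (frag_of \<omega>))" for a b
    using that contr by blast
  have "hcomult H (frag_of \<omega>) = frag_of (\<omega>, ?u) + frag_of (?u, \<omega>)"
  proof (rule poly_mapping_eqI)
    fix p :: "'a \<times> 'a"
    obtain a b where p: "p = (a, b)"
      by (cases p)
    consider "a = ?u" | "a \<noteq> ?u" "b = ?u" | "a \<noteq> ?u" "b \<noteq> ?u"
      by blast
    then show "poly_mapping.lookup (hcomult H (frag_of \<omega>)) p =
        poly_mapping.lookup (frag_of (\<omega>, ?u) + frag_of (?u, \<omega>)) p"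
    proof cases
      case 1
      then show ?thesis
        using lookup_comult_unit_left [of "frag_of \<omega>" b] \<omega> by (auto simp: p lookup_add)
    next
      case 2
      then show ?thesis
        using lookup_comult_unit_right [of "frag_of \<omega>" a] \<omega> by (auto simp: p lookup_add)
    next
      case 3
      then have "poly_mapping.lookup (hcomult H (frag_of \<omega>)) p = 0"
        using * p by (auto simp: in_keys_iff)
      with 3 show ?thesis
        by (auto simp: p lookup_add)
    qed
  qed
  with \<omega> show False
    by (simp add: \<C>_def primitive_def unit_one)
qed

lemma irreducible_in_\<Omega>_alg:
  assumes "\<omega> \<in> Irr H"
  shows "\<exists>\<phi>\<in>finsupp (\<C> H). \<omega> \<in> \<Omega>_alg H \<phi>"
  using assms
proof (induction "Deg H \<omega>" arbitrary: \<omega> rule: less_induct)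
  case less
  interpret reg: psh_module H 1 "regular_module H"
    by (rule regular_psh_module)
  consider "\<omega> = unit_irr H" | "\<omega> \<in> \<C> H" | "\<omega> \<noteq> unit_irr H" "\<omega> \<notin> \<C> H"
    by blast
  then show ?case
  proof cases
    case 1
    then show ?thesis
      by (intro bexI [of _ 0]) (simp_all add: \<Omega>_alg_eq_keys)
  next
    case 2
    have "pi_prod H (0 + Poly_Mapping.single \<omega> 1) = frag_of \<omega>"
      using 2 less.prems by (subst pi_prod_add_single) auto
    then show ?thesis
      using 2 by (intro bexI [of _ "Poly_Mapping.single \<omega> 1"]) (simp_all add: \<Omega>_alg_eq_keys)
  next
    case 3
    then obtain a b where ab: "(a, b) \<in> Poly_Mapping.keys (hcomult H (frag_of \<omega>))"
        "a \<noteq> unit_irr H" "b \<noteq> unit_irr H"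
      using comult_not_primitive [OF less.prems] by blast
    have abI: "a \<in> Irr H" "b \<in> Irr H"
      using comult_keys [of "frag_of \<omega>"] less.prems ab(1) by auto
    have "Deg H a + Deg H b = Deg H \<omega>"
      using reg.coact_degree [of \<omega> a b] less.prems ab(1) by simp
    \<comment> \<open>The degrees add up to that of \<omega>, so positivity of both makes both
      smaller.\<close>
    moreover have "Deg H a > 0" "Deg H b > 0"
      using Deg_eq_0_iff abI ab(2,3) by auto
    ultimately have "\<exists>\<phi>\<in>finsupp (\<C> H). a \<in> \<Omega>_alg H \<phi>" "\<exists>\<phi>\<in>finsupp (\<C> H). b \<in> \<Omega>_alg H \<phi>"
      using less.hyps abI by simp_all
    then obtain \<phi> \<psi> where \<phi>: "\<phi> \<in> finsupp (\<C> H)" "a \<in> \<Omega>_alg H \<phi>"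
      and \<psi>: "\<psi> \<in> finsupp (\<C> H)" "b \<in> \<Omega>_alg H \<psi>"
      by blast
    have "\<omega> \<in> Poly_Mapping.keys (hmult H (frag_of (a, b)))"
      using reg.coact_keys_iff_act_keys [of \<omega> a b] less.prems ab(1) abI by simp
    then have "\<omega> \<in> \<Omega>_alg H (\<phi> + \<psi>)"
      using reg.act_\<Omega>_keys [of "unit_irr H" \<phi> \<psi> a b] \<phi> \<psi> by (auto simp: \<Omega>_mod_regular)
    then show ?thesis
      using \<phi> \<psi> by (intro bexI [of _ "\<phi> + \<psi>"]) simp_all
  qed
qed

end

context psh_module
begin

text \<open>In a tensor \<open>(a, b)\<close> of the coaction with \<open>a\<close> not 1, only
  \<open>b\<close> has to have smaller degree than \<omega>: for \<open>a\<close> the result for the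
  algebra is available.\<close>

lemma irreducible_in_\<Omega>_mod:
  assumes "\<omega> \<in> mIrr M"
  shows "\<exists>d\<in>\<D> H M. \<exists>\<phi>\<in>finsupp (\<C> H). \<omega> \<in> \<Omega>_mod H M d \<phi>"
  using assms
proof (induction "mDeg M \<omega>" arbitrary: \<omega> rule: less_induct)
  case less
  show ?case
  proof (cases "\<omega> \<in> \<D> H M")
    case True
    then show ?thesis
      using mod_primitive_in_\<Omega>_mod by (intro bexI [of _ \<omega>] bexI [of _ 0]) auto
  next
    case False
    then obtain a b where ab: "(a, b) \<in> Poly_Mapping.keys (coact M (frag_of \<omega>))" "a \<noteq> unit_irr H"
      using coact_not_mod_primitive [OF less.prems] by blast
    have abI: "a \<in> Irr H" "b \<in> mIrr M"
      using coact_keys [of "frag_of \<omega>"] less.prems ab(1) by auto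
    have "mDeg M b < mDeg M \<omega>"
      using coact_degree [OF less.prems ab(1)] Deg_eq_0_iff [OF abI(1)] ab(2) by linarith
    then obtain d \<psi> where d: "d \<in> \<D> H M" and \<psi>: "\<psi> \<in> finsupp (\<C> H)" "b \<in> \<Omega>_mod H M d \<psi>"
      using less.hyps abI by blast
    obtain \<phi> where \<phi>: "\<phi> \<in> finsupp (\<C> H)" "a \<in> \<Omega>_alg H \<phi>"
      using irreducible_in_\<Omega>_alg abI by blast
    have "\<omega> \<in> \<Omega>_mod H M d (\<phi> + \<psi>)"
      using act_\<Omega>_keys [OF mod_primitive_in_mIrr [OF d] \<phi>(1) \<psi>(1) \<phi>(2) \<psi>(2)]
        coact_keys_iff_act_keys less.prems abI ab(1) by blast
    then show ?thesis
      using d \<phi>(1) \<psi>(1) by (intro bexI [of _ d] bexI [of _ "\<phi> + \<psi>"]) simp_all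
  qed
qed

lemma \<Omega>_mod_subset_mIrr: "\<Omega>_mod H M d \<phi> \<subseteq> mIrr M"
  by (auto simp: \<Omega>_mod_def constituents_def)

lemma \<Omega>_alg_subset_Irr: "\<Omega>_alg H \<phi> \<subseteq> Irr H"
  by (auto simp: \<Omega>_alg_def constituents_def)

text \<open>By adjointness \<omega> is a constituent of \<open>ab\<close>. Placing \<open>a\<close>
  and \<open>b\<close> in some parts puts \<omega> in the part of the summed exponents, and
  disjointness identifies that part with the given one.\<close>

lemma coact_\<Omega>_keys:
  assumes d: "d \<in> \<D> H M" and \<phi>: "\<phi> \<in> finsupp (\<C> H)" and \<omega>: "\<omega> \<in> \<Omega>_mod H M d \<phi>"
    and ab: "(a, b) \<in> Poly_Mapping.keys (coact M (frag_of \<omega>))"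
  obtains \<phi>' \<phi>'' where "\<phi>' \<in> finsupp (\<C> H)" "\<phi>'' \<in> finsupp (\<C> H)" "\<phi>' + \<phi>'' = \<phi>"
    "a \<in> \<Omega>_alg H \<phi>'" "b \<in> \<Omega>_mod H M d \<phi>''"
proof -
  have \<omega>I: "\<omega> \<in> mIrr M"
    using \<omega> \<Omega>_mod_subset_mIrr by blast
  then have abI: "a \<in> Irr H" "b \<in> mIrr M"
    using coact_keys [of "frag_of \<omega>"] ab by auto
  obtain \<phi>' where \<phi>': "\<phi>' \<in> finsupp (\<C> H)" "a \<in> \<Omega>_alg H \<phi>'"
    using irreducible_in_\<Omega>_alg abI by blast
  obtain d' \<phi>'' where d': "d' \<in> \<D> H M" and \<phi>'': "\<phi>'' \<in> finsupp (\<C> H)" "b \<in> \<Omega>_mod H M d' \<phi>''"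
    using irreducible_in_\<Omega>_mod abI by blast
  have "\<omega> \<in> \<Omega>_mod H M d' (\<phi>' + \<phi>'')"
    using act_\<Omega>_keys [OF mod_primitive_in_mIrr [OF d'] \<phi>'(1) \<phi>''(1) \<phi>'(2) \<phi>''(2)]
      coact_keys_iff_act_keys \<omega>I abI ab by blast
  then have "(d', \<phi>' + \<phi>'') = (d, \<phi>)"
    using \<Omega>_mod_disjoint [OF d' d finsupp_add [OF \<phi>'(1) \<phi>''(1)] \<phi>] \<omega> by blast
  then show thesis
    using that \<phi>' \<phi>'' by simp
qed

section \<open>The decomposition of a module\<close>

definition comp_irr :: "'m \<Rightarrow> 'm set"
  where "comp_irr d = (\<Union>\<phi>\<in>finsupp (\<C> H). \<Omega>_mod H M d \<phi>)"

lemma mod_comp_eq_tspan: "mod_comp H M d = tspan (comp_irr d)"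
  unfolding mod_comp_def comp_irr_def mod_part_def by (rule subgroup_sum_tspan)

lemma comp_irr_subset: "comp_irr d \<subseteq> mIrr M"
  unfolding comp_irr_def using \<Omega>_mod_subset_mIrr by blast

lemma irreducibles_in_mod_comp: "irreducibles_in (mIrr M) (mod_comp H M d) = comp_irr d"
  unfolding mod_comp_eq_tspan by (rule irreducibles_in_tspan [OF comp_irr_subset])

lemma UN_comp_irr: "(\<Union>d\<in>\<D> H M. comp_irr d) = mIrr M"
  unfolding comp_irr_def using irreducible_in_\<Omega>_mod \<Omega>_mod_subset_mIrr by fast

lemma comp_irr_disjoint:
  assumes "d \<in> \<D> H M" "d' \<in> \<D> H M" "d \<noteq> d'"
  shows "comp_irr d \<inter> comp_irr d' = {}"
  unfolding comp_irr_def using \<Omega>_mod_disjoint [OF assms(1,2)] assms(3) by fast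

lemma mod_primitive_in_comp_irr: "d \<in> \<D> H M \<Longrightarrow> d \<in> comp_irr d"
  unfolding comp_irr_def using mod_primitive_in_\<Omega>_mod finsupp_zero by blast

lemma disjoint_family_\<Omega>_mod:
  "disjoint_family_on (\<lambda>(d, \<phi>). \<Omega>_mod H M d \<phi>) (\<D> H M \<times> finsupp (\<C> H))"
  unfolding disjoint_family_on_def using \<Omega>_mod_disjoint by auto

lemma tgroup_direct_sum_mod_part:
  "tgroup_direct_sum (mIrr M) (\<D> H M \<times> finsupp (\<C> H)) (\<lambda>(d, \<phi>). mod_part H M d \<phi>)"
proof (rule tgroup_direct_sum_tspan [OF disjoint_family_\<Omega>_mod])
  show "(\<Union>i\<in>\<D> H M \<times> finsupp (\<C> H). case i of (d, \<phi>) \<Rightarrow> \<Omega>_mod H M d \<phi>) = mIrr M"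
    using UN_comp_irr by (auto simp: comp_irr_def)
qed (auto simp: mod_part_def simp del: carrier_free_Abelian_group_iff)

lemma act_mod_part:
  assumes d: "d \<in> \<D> H M" and \<phi>: "\<phi>' \<in> finsupp (\<C> H)" "\<phi>'' \<in> finsupp (\<C> H)"
  shows "act M ` (alg_part H \<phi>' \<otimes>\<^sub>s mod_part H M d \<phi>'') \<subseteq> mod_part H M d (\<phi>' + \<phi>'')"
  unfolding alg_part_def mod_part_def tspan_tensor_tspan
proof (intro image_subsetI)
  fix x assume "x \<in> tspan (\<Omega>_alg H \<phi>' \<times> \<Omega>_mod H M d \<phi>'')"
  then have x: "Poly_Mapping.keys x \<subseteq> \<Omega>_alg H \<phi>' \<times> \<Omega>_mod H M d \<phi>''"
    by simp
  have "Poly_Mapping.keys (act M x) \<subseteq> \<Omega>_mod H M d (\<phi>' + \<phi>'')"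
  proof (rule hom_free_keys_image [OF act_hom])
    show "Poly_Mapping.keys x \<subseteq> Irr H \<times> mIrr M"
      using x \<Omega>_alg_subset_Irr \<Omega>_mod_subset_mIrr by fast
    show "Poly_Mapping.keys (act M (frag_of p)) \<subseteq> \<Omega>_mod H M d (\<phi>' + \<phi>'')" if "p \<in> Poly_Mapping.keys x" for p
      using x that act_\<Omega>_keys [OF mod_primitive_in_mIrr [OF d] \<phi>] by (cases p) blast
  qed
  then show "act M x \<in> tspan (\<Omega>_mod H M d (\<phi>' + \<phi>''))"
    by simp
qed

lemma coact_mod_part:
  assumes d: "d \<in> \<D> H M" and \<phi>: "\<phi> \<in> finsupp (\<C> H)"
  defines "I \<equiv> {(\<phi>', \<phi>''). \<phi>' \<in> finsupp (\<C> H) \<and> \<phi>'' \<in> finsupp (\<C> H) \<and> \<phi>' + \<phi>'' = \<phi>}"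
    and "N \<equiv> (\<lambda>(\<phi>', \<phi>''). alg_part H \<phi>' \<otimes>\<^sub>s mod_part H M d \<phi>'')"
  shows "is_direct_sum (subgroup_sum I N) I N" "coact M ` mod_part H M d \<phi> \<subseteq> subgroup_sum I N"
proof -
  define S where "S = (\<lambda>(\<phi>', \<phi>''). \<Omega>_alg H \<phi>' \<times> \<Omega>_mod H M d \<phi>'')"
  have N: "N = (\<lambda>i. tspan (S i))"
    by (auto simp: N_def S_def alg_part_def mod_part_def tspan_tensor_tspan fun_eq_iff
        simp del: carrier_free_Abelian_group_iff)
  have sum: "subgroup_sum I N = tspan (\<Union>i\<in>I. S i)"
    unfolding N by (rule subgroup_sum_tspan)
  have "disjoint_family_on S I"
    unfolding disjoint_family_on_def
  proof (intro ballI impI)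
    fix i j assume ij: "i \<in> I" "j \<in> I" "i \<noteq> j"
    obtain \<phi>' \<phi>'' \<psi>' \<psi>'' where eq: "i = (\<phi>', \<phi>'')" "j = (\<psi>', \<psi>'')"
      by (cases i; cases j)
    \<comment> \<open>Both pairs sum to \<phi>, so equal first components would force equal second
      ones.\<close>
    have "\<phi>' \<noteq> \<psi>'"
      using ij by (auto simp: eq I_def)
    then have "\<Omega>_alg H \<phi>' \<inter> \<Omega>_alg H \<psi>' = {}"
      using ij by (intro \<Omega>_alg_disjoint) (auto simp: eq I_def)
    then show "S i \<inter> S j = {}"
      by (auto simp: S_def eq)
  qed
  then show "is_direct_sum (subgroup_sum I N) I N"
    unfolding sum by (rule is_direct_sum_tspan) (simp only: N)
  have "Poly_Mapping.keys (coact M x) \<subseteq> (\<Union>i\<in>I. S i)" if x: "Poly_Mapping.keys x \<subseteq> \<Omega>_mod H M d \<phi>" for x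
  proof (rule hom_free_keys_image [OF coact_hom])
    show "Poly_Mapping.keys x \<subseteq> mIrr M"
      using x \<Omega>_mod_subset_mIrr by blast
    fix \<omega> assume "\<omega> \<in> Poly_Mapping.keys x"
    then have \<omega>: "\<omega> \<in> \<Omega>_mod H M d \<phi>"
      using x by blast
    show "Poly_Mapping.keys (coact M (frag_of \<omega>)) \<subseteq> (\<Union>i\<in>I. S i)"
    proof (rule subrelI)
      fix a b assume "(a, b) \<in> Poly_Mapping.keys (coact M (frag_of \<omega>))"
      then obtain \<phi>' \<phi>'' where "(\<phi>', \<phi>'') \<in> I" "(a, b) \<in> S (\<phi>', \<phi>'')"
        by (rule coact_\<Omega>_keys [OF d \<phi> \<omega>]) (auto simp: I_def S_def)
      then show "(a, b) \<in> (\<Union>i\<in>I. S i)"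
        by blast
    qed
  qed
  then show "coact M ` mod_part H M d \<phi> \<subseteq> subgroup_sum I N"
    unfolding sum mod_part_def by auto
qed

lemma is_direct_sum_mod_comp:
  assumes "d \<in> \<D> H M"
  shows "is_direct_sum (mod_comp H M d) (finsupp (\<C> H)) (mod_part H M d)"
  unfolding mod_comp_eq_tspan comp_irr_def
proof (rule is_direct_sum_tspan)
  show "disjoint_family_on (\<Omega>_mod H M d) (finsupp (\<C> H))"
    unfolding disjoint_family_on_def using \<Omega>_mod_disjoint [OF assms assms] by auto
qed (simp only: mod_part_def)

lemma psh_submodule_mod_comp:
  assumes d: "d \<in> \<D> H M"
  shows "psh_submodule H M (mod_comp H M d)"
  unfolding psh_submodule_def mod_comp_eq_tspan tspan_tensor_tspan
proof (intro conjI exI image_subsetI)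
  fix x assume "x \<in> tspan (Irr H \<times> comp_irr d)"
  then have x: "Poly_Mapping.keys x \<subseteq> Irr H \<times> comp_irr d"
    by simp
  have "Poly_Mapping.keys (act M x) \<subseteq> comp_irr d"
  proof (rule hom_free_keys_image [OF act_hom])
    show "Poly_Mapping.keys x \<subseteq> Irr H \<times> mIrr M"
      using x comp_irr_subset by fast
    fix p assume "p \<in> Poly_Mapping.keys x"
    then obtain a b where p: "p = (a, b)" "a \<in> Irr H" "b \<in> comp_irr d"
      using x by fast
    \<comment> \<open>Every irreducible of \<open>H\<close> lies in some part of \<open>H\<close>,
      so the action of all of \<open>H\<close> changes the exponent but never
      \<open>d\<close>.\<close>
    obtain \<phi> where \<phi>: "\<phi> \<in> finsupp (\<C> H)" "a \<in> \<Omega>_alg H \<phi>"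
      using irreducible_in_\<Omega>_alg p(2) by blast
    obtain \<psi> where \<psi>: "\<psi> \<in> finsupp (\<C> H)" "b \<in> \<Omega>_mod H M d \<psi>"
      using p(3) by (auto simp: comp_irr_def)
    have "\<Omega>_mod H M d (\<phi> + \<psi>) \<subseteq> comp_irr d"
      using \<phi>(1) \<psi>(1) by (auto simp: comp_irr_def intro!: bexI [of _ "\<phi> + \<psi>"])
    then show "Poly_Mapping.keys (act M (frag_of p)) \<subseteq> comp_irr d"
      using act_\<Omega>_keys [OF mod_primitive_in_mIrr [OF d] \<phi>(1) \<psi>(1) \<phi>(2) \<psi>(2)] p(1) by blast
  qed
  then show "act M x \<in> tspan (comp_irr d)"
    by simp
next
  fix x assume "x \<in> tspan (comp_irr d)"
  then have x: "Poly_Mapping.keys x \<subseteq> comp_irr d"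
    by simp
  have "Poly_Mapping.keys (coact M x) \<subseteq> Irr H \<times> comp_irr d"
  proof (rule hom_free_keys_image [OF coact_hom])
    show "Poly_Mapping.keys x \<subseteq> mIrr M"
      using x comp_irr_subset by blast
    fix \<omega> assume "\<omega> \<in> Poly_Mapping.keys x"
    then obtain \<phi> where \<phi>: "\<phi> \<in> finsupp (\<C> H)" and \<omega>: "\<omega> \<in> \<Omega>_mod H M d \<phi>"
      using x by (auto simp: comp_irr_def)
    show "Poly_Mapping.keys (coact M (frag_of \<omega>)) \<subseteq> Irr H \<times> comp_irr d"
    proof (rule subrelI)
      fix a b assume "(a, b) \<in> Poly_Mapping.keys (coact M (frag_of \<omega>))"
      then obtain \<phi>' \<phi>'' where "\<phi>'' \<in> finsupp (\<C> H)" "a \<in> \<Omega>_alg H \<phi>'" "b \<in> \<Omega>_mod H M d \<phi>''"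
        using coact_\<Omega>_keys [OF d \<phi> \<omega>] by metis
      then show "(a, b) \<in> Irr H \<times> comp_irr d"
        using \<Omega>_alg_subset_Irr by (auto simp: comp_irr_def)
    qed
  qed
  then show "coact M x \<in> tspan (Irr H \<times> comp_irr d)"
    by simp
qed (rule comp_irr_subset refl)+

lemma submodule_direct_sum_mod_comp: "submodule_direct_sum H M (\<D> H M) (mod_comp H M)"
  unfolding submodule_direct_sum_def
proof (intro conjI ballI psh_submodule_mod_comp)
  show "tgroup_direct_sum (mIrr M) (\<D> H M) (mod_comp H M)"
    by (rule tgroup_direct_sum_tspan [OF _ UN_comp_irr mod_comp_eq_tspan])
      (use comp_irr_disjoint in \<open>auto simp: disjoint_family_on_def\<close>)
qed

section \<open>Decompositions whose summands have a single primitive element\<close>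

lemma frag_of_in_mod_comp_iff:
  assumes "d \<in> \<D> H M" "d' \<in> \<D> H M"
  shows "frag_of d \<in> mod_comp H M d' \<longleftrightarrow> d = d'"
  using comp_irr_disjoint [OF assms] mod_primitive_in_comp_irr assms by (auto simp: mod_comp_eq_tspan)

lemma single_primitive_decomposition_mod_comp:
  "single_primitive_decomposition H M (mod_comp H M ` \<D> H M)"
  unfolding single_primitive_decomposition_def submodule_direct_sum_def
proof (intro conjI ballI)
  show "psh_submodule H M N" if "N \<in> mod_comp H M ` \<D> H M" for N
    using that psh_submodule_mod_comp by blast
  show "tgroup_direct_sum (mIrr M) (mod_comp H M ` \<D> H M) (\<lambda>N. N)"
  proof (rule tgroup_direct_sum_tspan [of "irreducibles_in (mIrr M)"])
    show "disjoint_family_on (irreducibles_in (mIrr M)) (mod_comp H M ` \<D> H M)"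
      unfolding disjoint_family_on_def using comp_irr_disjoint by (fastforce simp: irreducibles_in_mod_comp)
    show "(\<Union>N\<in>mod_comp H M ` \<D> H M. irreducibles_in (mIrr M) N) = mIrr M"
      using UN_comp_irr by (simp add: irreducibles_in_mod_comp)
    show "N = tspan (irreducibles_in (mIrr M) N)" if "N \<in> mod_comp H M ` \<D> H M" for N
    proof -
      from that obtain d where "N = mod_comp H M d"
        by blast
      then show ?thesis
        by (simp only: irreducibles_in_mod_comp) (rule mod_comp_eq_tspan)
    qed
  qed
  show "\<exists>!d. d \<in> \<D> H M \<and> frag_of d \<in> N" if "N \<in> mod_comp H M ` \<D> H M" for N
    using that frag_of_in_mod_comp_iff by blast
qed

text \<open>Stability under the action puts each \<open>pi_mod H M d \<phi>\<close> in
  \<open>N\<close>. As \<open>N\<close> is spanned by irreducible elements, it also contains their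
  constituents.\<close>

lemma mod_comp_subset_submodule:
  assumes N: "psh_submodule H M N" and d: "d \<in> \<D> H M" "frag_of d \<in> N"
  shows "mod_comp H M d \<subseteq> N"
proof -
  obtain S where S: "N = tspan S" and act: "act M ` (tspan (Irr H) \<otimes>\<^sub>s N) \<subseteq> N"
    using N by (auto simp: psh_submodule_def)
  have dS: "d \<in> S"
    using d(2) S by simp
  have "\<Omega>_mod H M d \<phi> \<subseteq> S" if \<phi>: "\<phi> \<in> finsupp (\<C> H)" for \<phi>
  proof -
    have "pi_prod H \<phi> \<otimes>\<^sub>t frag_of d \<in> tspan (Irr H) \<otimes>\<^sub>s N"
      unfolding S tspan_tensor_tspan using pi_prod_keys [OF \<phi>] dS by auto
    then have "pi_mod H M d \<phi> \<in> tspan S"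
      using act S by (auto simp: pi_mod_def simp del: carrier_free_Abelian_group_iff)
    then show ?thesis
      using mod_primitive_in_mIrr [OF d(1)] \<phi> by (simp add: \<Omega>_mod_eq_keys)
  qed
  then show ?thesis
    unfolding S mod_comp_eq_tspan comp_irr_def by (intro tspan_mono UN_least)
qed

text \<open>Each summand contains the component of its primitive element. Since these components
  exhaust the irreducible elements and the summands are disjoint, no summand can contain
  more.\<close>

lemma single_primitive_decomposition_unique:
  assumes \<N>: "single_primitive_decomposition H M \<N>"
  shows "\<N> = mod_comp H M ` \<D> H M"
proof -
  let ?irr = "irreducibles_in (mIrr M)"
  have sub: "psh_submodule H M N" and prim: "\<exists>!d. d \<in> \<D> H M \<and> frag_of d \<in> N"
    and tspan: "N = tspan (?irr N)" if "N \<in> \<N>" for N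
    using \<N> that by (auto simp: single_primitive_decomposition_def submodule_direct_sum_def tgroup_direct_sum_def
        simp del: carrier_free_Abelian_group_iff)
  have disj: "N = N'" if "N \<in> \<N>" "N' \<in> \<N>" "\<omega> \<in> ?irr N" "\<omega> \<in> ?irr N'" for N N' \<omega>
    using \<N> that unfolding single_primitive_decomposition_def submodule_direct_sum_def tgroup_direct_sum_def
      disjoint_family_on_def by blast
  have un: "(\<Union>N\<in>\<N>. ?irr N) = mIrr M"
    using \<N> unfolding single_primitive_decomposition_def submodule_direct_sum_def tgroup_direct_sum_def
    by blast
  have eq: "N = mod_comp H M d" if N: "N \<in> \<N>" and d: "d \<in> \<D> H M" "frag_of d \<in> N" for N d
  proof
    show "mod_comp H M d \<subseteq> N"
      using mod_comp_subset_submodule [OF sub [OF N] d] .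
    have "?irr N \<subseteq> comp_irr d"
    proof
      fix \<omega> assume \<omega>: "\<omega> \<in> ?irr N"
      then obtain d' where d': "d' \<in> \<D> H M" "\<omega> \<in> comp_irr d'"
        using UN_comp_irr by (auto simp: irreducibles_in_def)
      \<comment> \<open>The summand containing \<open>d'\<close> contains its whole component and
        hence \<omega>, so it is \<open>N\<close>; then \<open>d'\<close> is the single primitive of
        \<open>N\<close>, that is, \<open>d\<close>.\<close>
      obtain N' where N': "N' \<in> \<N>" "frag_of d' \<in> N'"
        using un mod_primitive_in_mIrr [OF d'(1)] by (auto simp: irreducibles_in_def)
      have "?irr (mod_comp H M d') \<subseteq> ?irr N'"
        using mod_comp_subset_submodule [OF sub [OF N'(1)] d'(1) N'(2)] by (auto simp: irreducibles_in_def)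
      then have "N = N'"
        using disj [OF N N'(1) \<omega>] d'(2) by (auto simp: irreducibles_in_mod_comp)
      then show "\<omega> \<in> comp_irr d"
        using prim [OF N] d d' N'(2) by blast
    qed
    then show "N \<subseteq> mod_comp H M d"
      unfolding mod_comp_eq_tspan by (subst tspan [OF N]) (rule tspan_mono)
  qed
  show ?thesis
  proof
    show "\<N> \<subseteq> mod_comp H M ` \<D> H M"
    proof
      fix N assume N: "N \<in> \<N>"
      then obtain d where "d \<in> \<D> H M" "frag_of d \<in> N"
        using prim by blast
      with eq [OF N] show "N \<in> mod_comp H M ` \<D> H M"
        by blast
    qed
    show "mod_comp H M ` \<D> H M \<subseteq> \<N>"
    proof (rule image_subsetI)
      fix d assume d: "d \<in> \<D> H M"
      then obtain N where "N \<in> \<N>" "frag_of d \<in> N"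
        using un mod_primitive_in_mIrr [OF d] by (auto simp: irreducibles_in_def)
      then show "mod_comp H M d \<in> \<N>"
        using eq d by blast
    qed
  qed
qed

end

theorem theorem14:
  fixes k :: nat and H :: "'a psh" and M :: "('a, 'm) psh_mod"
  assumes "psh_algebra H" and "psh_module H k M"
  shows
    "(\<forall>d\<in>\<D> H M. \<forall>d'\<in>\<D> H M. \<forall>\<phi>\<in>finsupp (\<C> H). \<forall>\<phi>'\<in>finsupp (\<C> H).
        (d, \<phi>) \<noteq> (d', \<phi>') \<longrightarrow> \<Omega>_mod H M d \<phi> \<inter> \<Omega>_mod H M d' \<phi>' = {})
     \<and> tgroup_direct_sum (mIrr M) (\<D> H M \<times> finsupp (\<C> H)) (\<lambda>(d, \<phi>). mod_part H M d \<phi>)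
     \<and> (\<forall>d\<in>\<D> H M. \<forall>\<phi>'\<in>finsupp (\<C> H). \<forall>\<phi>''\<in>finsupp (\<C> H).
          act M ` (alg_part H \<phi>' \<otimes>\<^sub>s mod_part H M d \<phi>'') \<subseteq> mod_part H M d (\<phi>' + \<phi>''))
     \<and> (\<forall>d\<in>\<D> H M. \<forall>\<phi>\<in>finsupp (\<C> H).
          let I = {(\<phi>', \<phi>''). \<phi>' \<in> finsupp (\<C> H) \<and> \<phi>'' \<in> finsupp (\<C> H) \<and> \<phi>' + \<phi>'' = \<phi>};
              N = (\<lambda>(\<phi>', \<phi>''). alg_part H \<phi>' \<otimes>\<^sub>s mod_part H M d \<phi>'')
          in is_direct_sum (subgroup_sum I N) I N \<and> coact M ` mod_part H M d \<phi> \<subseteq> subgroup_sum I N)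
     \<and> (\<forall>d\<in>\<D> H M. is_direct_sum (mod_comp H M d) (finsupp (\<C> H)) (mod_part H M d))
     \<and> (\<forall>d\<in>\<D> H M. psh_submodule H M (mod_comp H M d))
     \<and> submodule_direct_sum H M (\<D> H M) (mod_comp H M)
     \<and> single_primitive_decomposition H M (mod_comp H M ` \<D> H M)
     \<and> (\<exists>!\<N>. single_primitive_decomposition H M \<N>)"
proof -
  interpret psh_module H k M
    by fact
  have "\<exists>!\<N>. single_primitive_decomposition H M \<N>"
    using single_primitive_decomposition_mod_comp single_primitive_decomposition_unique by blast
  then show ?thesis
    unfolding Let_def
    by (intro conjI ballI impI \<Omega>_mod_disjoint tgroup_direct_sum_mod_part act_mod_part coact_mod_part
        is_direct_sum_mod_comp psh_submodule_mod_comp submodule_direct_sum_mod_comp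
        single_primitive_decomposition_mod_comp) assumption+
qed

end
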